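(* Let $n\ge 1$, $\alpha\in\mathbb{R}\setminus\pi\mathbb{Z}$, and let $m$ be a bounded measurable function on $\mathbb{R}^n$. Put $m_\alpha(\xi):=m((\sin\alpha)\xi)$. Then $$T_m^\alpha=M_\alpha^{-1}\,T_{m_\alpha}\,M_\alpha ,$$ and for every $1\le p\le\infty$, $$\|T_m^\alpha\|_{L^p\to L^p}=\|T_{m_\alpha}\|_{L^p\to L^p}.$$
   Context: Fourier transform: $\widehat f(\xi)=\int_{\mathbb{R}^n}e^{-2\pi i x\cdot\xi}f(x)\,dx$, with inverse Fourier transform denoted $f\mapsto f^\vee$. The chirp multiplier is $(M_\alpha f)(x):=e^{\pi i|x|^2\cot\alpha}f(x)$, and $M_\alpha^{-1}$ is multiplication by $e^{-\pi i|x|^2\cot\alpha}$. The fractional Fourier transform (FrFT) at angle $\alpha$ is $$(\mathcal F_\alpha f)(\xi)=c_{\alpha,n}\,|\sin\alpha|^{-n/2}\,e^{\pi i|\xi|^2\cot\alpha}\,\widehat{M_\alpha f}\Bigl(\frac{\xi}{\sin\alpha}\Bigr),$$ where $c_{\alpha,n}$ is a fixed complex constant of modulus one. For a bounded measurable function $m$, the classical Fourier multiplier is $T_m g:=(m\,\widehat g)^\vee$ and the FrFT multiplier is $T_m^\alpha f:=\mathcal F_\alpha^{-1}(m\,\mathcal F_\alpha f)$. Both are initially defined on Schwartz functions; the $L^p\to L^p$ operator norms are the (possibly infinite) suprema over nonzero Schwartz functions of the ratio of output to input $L^p(\mathbb{R}^n)$ norms. *)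

theory Defs
  imports "HOL-Analysis.Analysis" "HOL-Probability.Essential_Supremum"
begin

text \<open>
  \<open>\<real>\<^sup>n\<close> is the type \<open>real ^ 'n\<close> with \<open>n = CARD('n)\<close>. Functions are complex valued, and
  measurability, integrals and ``almost everywhere'' refer to (complete) Lebesgue measure.
\<close>

subsection \<open>Schwartz functions\<close>

definition partial :: "'n::finite \<Rightarrow> (real ^ 'n \<Rightarrow> complex) \<Rightarrow> real ^ 'n \<Rightarrow> complex" where
  "partial i f x = frechet_derivative f (at x) (axis i 1)"

text \<open>
  The list \<open>is\<close> of coordinate directions plays the role of a multi-index of order \<open>length is\<close>.
\<close>

definition partials :: "'n::finite list \<Rightarrow> (real ^ 'n \<Rightarrow> complex) \<Rightarrow> real ^ 'n \<Rightarrow> complex" where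
  "partials is f = foldr partial is f"

text \<open>
  Differentiability of all iterated partial derivatives is \<open>C\<^sup>\<infinity>\<close> smoothness.
\<close>

definition schwartz :: "(real ^ 'n::finite \<Rightarrow> complex) \<Rightarrow> bool" where
  "schwartz f \<longleftrightarrow>
     (\<forall>is x. partials is f differentiable (at x)) \<and>
     (\<forall>is (k::nat). \<exists>C. \<forall>x. norm x ^ k * norm (partials is f x) \<le> C)"

subsection \<open>Lebesgue norms\<close>

text \<open>
  For \<open>p < \<infinity>\<close> the case distinction computes the \<open>p\<close>-th root of an extended nonnegative real.
  The value is meaningful for measurable \<open>f\<close> and \<open>1 \<le> p \<le> \<infinity>\<close>.
\<close>

definition Lp_norm :: "ennreal \<Rightarrow> (real ^ 'n::finite \<Rightarrow> complex) \<Rightarrow> ennreal" where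
  "Lp_norm p f =
     (if p = \<infinity> then esssup lebesgue (\<lambda>x. ennreal (norm (f x)))
      else let I = (\<integral>\<^sup>+ x. ennreal (norm (f x) powr enn2real p) \<partial>lebesgue)
           in if I = \<infinity> then \<infinity> else ennreal (enn2real I powr (1 / enn2real p)))"

definition L2_fun :: "(real ^ 'n::finite \<Rightarrow> complex) \<Rightarrow> bool" where
  "L2_fun f \<longleftrightarrow> f \<in> borel_measurable lebesgue \<and> Lp_norm 2 f < \<infinity>"

text \<open>
  Operators are defined on Schwartz functions only; the supremum may be infinite.
\<close>

definition Lp_opnorm ::
  "ennreal \<Rightarrow> ((real ^ 'n::finite \<Rightarrow> complex) \<Rightarrow> real ^ 'n \<Rightarrow> complex) \<Rightarrow> ennreal" where
  "Lp_opnorm p T =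
     (SUP f \<in> {f. schwartz f \<and> f \<noteq> (\<lambda>_. 0)}. Lp_norm p (T f) / Lp_norm p f)"

subsection \<open>Fourier transform and Fourier multipliers\<close>

definition fourier :: "(real ^ 'n::finite \<Rightarrow> complex) \<Rightarrow> real ^ 'n \<Rightarrow> complex" where
  "fourier f \<xi> = (LINT x|lebesgue. cis (- 2 * pi * (x \<bullet> \<xi>)) * f x)"

definition inv_fourier :: "(real ^ 'n::finite \<Rightarrow> complex) \<Rightarrow> real ^ 'n \<Rightarrow> complex" where
  "inv_fourier g x = (LINT \<xi>|lebesgue. cis (2 * pi * (x \<bullet> \<xi>)) * g \<xi>)"

definition fourier_mult ::
  "(real ^ 'n::finite \<Rightarrow> complex) \<Rightarrow> (real ^ 'n \<Rightarrow> complex) \<Rightarrow> real ^ 'n \<Rightarrow> complex" where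
  "fourier_mult m g = inv_fourier (\<lambda>\<xi>. m \<xi> * fourier g \<xi>)"

subsection \<open>Fractional Fourier transform and its multipliers\<close>

definition chirp :: "real \<Rightarrow> (real ^ 'n::finite \<Rightarrow> complex) \<Rightarrow> real ^ 'n \<Rightarrow> complex" where
  "chirp \<alpha> f x = cis (pi * (norm x)\<^sup>2 * cot \<alpha>) * f x"

definition inv_chirp :: "real \<Rightarrow> (real ^ 'n::finite \<Rightarrow> complex) \<Rightarrow> real ^ 'n \<Rightarrow> complex" where
  "inv_chirp \<alpha> f x = cis (- pi * (norm x)\<^sup>2 * cot \<alpha>) * f x"

text \<open>
  The parameter \<open>c\<close> is the unimodular normalising constant \<open>c\<^bsub>\<alpha>,n\<^esub>\<close>.
\<close>

definition frft ::
  "complex \<Rightarrow> real \<Rightarrow> (real ^ 'n::finite \<Rightarrow> complex) \<Rightarrow> real ^ 'n \<Rightarrow> complex" where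
  "frft c \<alpha> f \<xi> =
     c * of_real (\<bar>sin \<alpha>\<bar> powr (- (real CARD('n) / 2)))
       * cis (pi * (norm \<xi>)\<^sup>2 * cot \<alpha>) * fourier (chirp \<alpha> f) (\<xi> /\<^sub>R sin \<alpha>)"

text \<open>
  For Schwartz \<open>f\<close> and bounded measurable \<open>m\<close>, the product of \<open>m\<close> with the transform of \<open>f\<close> is in
  general not the transform of a Schwartz (or even of an integrable) function, so the inverse of
  the fractional Fourier transform is taken on \<open>L\<^sup>2\<close>, to which the transform extends from the
  dense subspace of Schwartz functions by continuity. \<open>frft_L2 c \<alpha> h g\<close> says that this extension
  maps \<open>h\<close> to \<open>g\<close>. Elements of \<open>L\<^sup>2\<close> are represented by functions, so \<open>inv_frft c \<alpha> g\<close> is a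
  representative of the preimage of \<open>g\<close>, determined up to equality almost everywhere.
\<close>

definition frft_L2 ::
  "complex \<Rightarrow> real \<Rightarrow> (real ^ 'n::finite \<Rightarrow> complex) \<Rightarrow> (real ^ 'n \<Rightarrow> complex) \<Rightarrow> bool" where
  "frft_L2 c \<alpha> h g \<longleftrightarrow>
     L2_fun h \<and> L2_fun g \<and>
     (\<exists>\<phi>::nat \<Rightarrow> real ^ 'n \<Rightarrow> complex. (\<forall>k. schwartz (\<phi> k)) \<and>
        (\<lambda>k. Lp_norm 2 (\<lambda>x. \<phi> k x - h x)) \<longlonglongrightarrow> 0 \<and>
        (\<lambda>k. Lp_norm 2 (\<lambda>\<xi>. frft c \<alpha> (\<phi> k) \<xi> - g \<xi>)) \<longlonglongrightarrow> 0)"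

definition inv_frft ::
  "complex \<Rightarrow> real \<Rightarrow> (real ^ 'n::finite \<Rightarrow> complex) \<Rightarrow> real ^ 'n \<Rightarrow> complex" where
  "inv_frft c \<alpha> g = (SOME h. frft_L2 c \<alpha> h g)"

definition frft_mult ::
  "complex \<Rightarrow> real \<Rightarrow> (real ^ 'n::finite \<Rightarrow> complex) \<Rightarrow> (real ^ 'n \<Rightarrow> complex)
     \<Rightarrow> real ^ 'n \<Rightarrow> complex" where
  "frft_mult c \<alpha> m f = inv_frft c \<alpha> (\<lambda>\<xi>. m \<xi> * frft c \<alpha> f \<xi>)"

end

theory Submission
  imports Defs "HOL-Probability.Probability"
begin

text \<open>
  Chirping turns the fractional transform into a dilated ordinary Fourier transform. Write
  \<open>u\<close> for the multiplier \<open>m\<^sub>\<alpha>\<close> times the Fourier transform of the chirped function. Undoing chirp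
  and dilation, a sequence of Schwartz functions witnesses that the \<open>L\<^sup>2\<close> extension of the
  fractional transform maps \<open>h\<close> to \<open>m\<close> times the transform of \<open>f\<close> iff the chirped sequence \<open>\<psi>\<close>
  tends to the chirped \<open>h\<close> while its Fourier transforms tend to \<open>u\<close>, both in \<open>L\<^sup>2\<close>. Since \<open>u\<close> is
  integrable and square integrable, inversion for Schwartz functions together with an \<open>L\<^sup>2\<close> bound
  for the inverse transform in both directions makes the two \<open>L\<^sup>2\<close> errors of \<open>\<psi>\<close> against the
  inverse transform of \<open>u\<close> and of its transform against \<open>u\<close> comparable; this gives existence
  (Schwartz functions are dense) and uniqueness of \<open>h\<close>. Chirps are unimodular and permute the
  Schwartz functions, so all operator norms agree.

  Inversion and the \<open>L\<^sup>2\<close> bound both come from inserting a Gaussian on the frequency side, which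
  turns into a Gaussian averaging kernel in space.
\<close>

section \<open>Change of variables and product integrals for Lebesgue measure\<close>

text \<open>Every comparison therefore passes through the difference of a Schwartz transform and
  \<open>u\<close>. Such a difference stays integrable and square integrable because the Fourier
  transform of a Schwartz function is bounded by a multiple of \<open>decay_weight\<close>. The
  lower bound for the inverse transform is first known for Schwartz functions, by inversion, and
  reaches these differences by density. Only convergence of errors to zero is passed on, so
  inequalities up to a factor can replace the Plancherel identity, and squared norms with a
  quasi-triangle inequality can replace norms. The preimage is picked by \<open>SOME\<close>:
  existence is what gives the chosen function any property at all, and uniqueness identifies it
  almost everywhere, which is all that L^p norms see.\<close>

lemma sigma_finite_lebesgue: "sigma_finite_measure (lebesgue :: 'a::euclidean_space measure)"
proof
  obtain A :: "'a set set" where "countable A" "A \<subseteq> sets lborel" "\<Union> A = space lborel"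
    "\<forall>a\<in>A. emeasure lborel a \<noteq> \<infinity>"
    using lborel.sigma_finite_countable by blast
  then show "\<exists>A::'a set set. countable A \<and> A \<subseteq> sets lebesgue \<and> \<Union> A = space lebesgue \<and>
      (\<forall>a\<in>A. emeasure lebesgue a \<noteq> \<infinity>)"
    by (intro exI[of _ A]) (auto simp: subset_iff)
qed

interpretation leb: sigma_finite_measure "lebesgue :: 'a::euclidean_space measure"
  by (rule sigma_finite_lebesgue)

interpretation leb2: pair_sigma_finite "lebesgue :: 'a::euclidean_space measure"
  "lebesgue :: 'b::euclidean_space measure" ..

lemma measurable_lebesgue_of_borel:
  "f \<in> borel_measurable borel \<Longrightarrow> f \<in> borel_measurable lebesgue"
  by (simp add: measurable_completion)

context
  fixes t :: "'a::euclidean_space" and c :: real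
  assumes c: "c \<noteq> 0"
begin

text \<open>The special case of a coordinatewise scaling with all factors equal. Negative
  \<open>c\<close> is included, so that translations, dilations and the reflection all come from
  this one formula.\<close>

lemma lebesgue_affine_iso: "lebesgue = density (distr lebesgue lebesgue (\<lambda>x. t + c *\<^sub>R x)) (\<lambda>_. ennreal (\<bar>c\<bar> ^ DIM('a)))"
  using lebesgue_affine_euclidean[of "\<lambda>_::'a. c" t] c
  unfolding scaleR_scaleR[symmetric] scaleR_sum_right[symmetric] euclidean_representation prod_constant
  by simp

lemma measurable_lebesgue_affine: "(\<lambda>x::'a. t + c *\<^sub>R x) \<in> lebesgue \<rightarrow>\<^sub>M lebesgue"
  using lebesgue_affine_measurable[of "\<lambda>_::'a. c" t] c
  unfolding scaleR_scaleR[symmetric] scaleR_sum_right[symmetric] euclidean_representation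
  by simp

lemma borel_measurable_lebesgue_affine:
  "f \<in> borel_measurable lebesgue \<Longrightarrow> (\<lambda>x. f (t + c *\<^sub>R x)) \<in> borel_measurable lebesgue"
  using measurable_compose[OF measurable_lebesgue_affine] .

lemma nn_integral_lebesgue_affine:
  assumes f[measurable]: "f \<in> borel_measurable lebesgue"
  shows "(\<integral>\<^sup>+x. f x \<partial>lebesgue) = ennreal (\<bar>c\<bar> ^ DIM('a)) * (\<integral>\<^sup>+x. f (t + c *\<^sub>R x) \<partial>lebesgue)"
proof -
  note [measurable] = measurable_lebesgue_affine
  have "(\<integral>\<^sup>+x. f x \<partial>lebesgue) = (\<integral>\<^sup>+x. f x \<partial>density (distr lebesgue lebesgue (\<lambda>x. t + c *\<^sub>R x)) (\<lambda>x. ennreal (\<bar>c\<bar> ^ DIM('a))))"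
    using lebesgue_affine_iso by simp
  also have "\<dots> = ennreal (\<bar>c\<bar> ^ DIM('a)) * (\<integral>\<^sup>+x. f (t + c *\<^sub>R x) \<partial>lebesgue)"
    by (simp add: nn_integral_density nn_integral_cmult nn_integral_distr)
  finally show ?thesis .
qed

lemma integrable_lebesgue_affine:
  fixes f :: "'a \<Rightarrow> 'b::{banach, second_countable_topology}"
  assumes f: "integrable lebesgue f"
  shows "integrable lebesgue (\<lambda>x. f (t + c *\<^sub>R x))"
proof (rule integrableI_bounded)
  have m: "f \<in> borel_measurable lebesgue" using f by auto
  show "(\<lambda>x. f (t + c *\<^sub>R x)) \<in> borel_measurable lebesgue"
    by (rule borel_measurable_lebesgue_affine[OF m])
  have "ennreal (\<bar>c\<bar> ^ DIM('a)) * (\<integral>\<^sup>+x. norm (f (t + c *\<^sub>R x)) \<partial>lebesgue) < \<infinity>"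
    using f m by (subst nn_integral_lebesgue_affine[symmetric, where f="\<lambda>x. ennreal (norm (f x))"])
      (auto simp: integrable_iff_bounded)
  then show "(\<integral>\<^sup>+x. norm (f (t + c *\<^sub>R x)) \<partial>lebesgue) < \<infinity>"
    using c by (auto simp: ennreal_mult_less_top)
qed

lemma integral_lebesgue_affine:
  fixes f :: "'a \<Rightarrow> 'b::{banach, second_countable_topology}"
  assumes f[measurable]: "f \<in> borel_measurable lebesgue"
  shows "(LINT x|lebesgue. f x) = \<bar>c\<bar> ^ DIM('a) *\<^sub>R (LINT x|lebesgue. f (t + c *\<^sub>R x))"
proof -
  note [measurable] = measurable_lebesgue_affine
  have "(LINT x|lebesgue. f x) = (LINT x|density (distr lebesgue lebesgue (\<lambda>x. t + c *\<^sub>R x)) (\<lambda>x. ennreal (\<bar>c\<bar> ^ DIM('a))). f x)"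
    using lebesgue_affine_iso by simp
  also have "\<dots> = \<bar>c\<bar> ^ DIM('a) *\<^sub>R (LINT x|lebesgue. f (t + c *\<^sub>R x))"
    by (subst integral_density) (simp_all add: integral_distr)
  finally show ?thesis .
qed

end

lemma integral_lebesgue_translation:
  fixes f :: "'a::euclidean_space \<Rightarrow> 'b::{banach, second_countable_topology}"
  assumes "f \<in> borel_measurable lebesgue"
  shows "(LINT x|lebesgue. f (x + t)) = (LINT x|lebesgue. f x)"
  using integral_lebesgue_affine[of 1 f t] assms by (simp add: add.commute)

lemma integrable_lebesgue_translation:
  fixes f :: "'a::euclidean_space \<Rightarrow> 'b::{banach, second_countable_topology}"
  assumes "integrable lebesgue f"
  shows "integrable lebesgue (\<lambda>x. f (x + t))"
  using integrable_lebesgue_affine[of 1 f t] assms by (simp add: add.commute)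

lemma integral_lebesgue_reflect:
  fixes f :: "'a::euclidean_space \<Rightarrow> 'b::{banach, second_countable_topology}"
  assumes "f \<in> borel_measurable lebesgue"
  shows "(LINT x|lebesgue. f (- x)) = (LINT x|lebesgue. f x)"
  using integral_lebesgue_affine[of "-1" f 0] assms by simp

lemma prod_Basis_cart: "(\<Prod>b\<in>Basis. f (axis_index b) (x \<bullet> b)) = (\<Prod>i\<in>UNIV. f i (x $ i))"
  for x :: "real ^ 'n::finite"
proof -
  have B: "(Basis :: (real^'n) set) = range (\<lambda>i. axis i 1)"
    by (auto simp: Basis_vec_def)
  have "inj (\<lambda>i::'n. axis i (1::real))"
    by (auto simp: inj_on_def axis_eq_axis)
  then show ?thesis
    unfolding B by (subst prod.reindex) (simp_all add: inner_axis)
qed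

text \<open>Lebesgue measure on R^n is the image of a product measure indexed by
  \<open>Basis\<close>, so the product is taken over \<open>Basis\<close> first and reindexed by
  coordinates at the end. Borel measurability carries both claims from \<open>lborel\<close> to its
  completion.\<close>

lemma
  fixes f :: "'n::finite \<Rightarrow> real \<Rightarrow> 'b::{real_normed_field,banach,second_countable_topology}"
  assumes f: "\<And>i. integrable lborel (f i)"
  shows integrable_lebesgue_prod: "integrable lebesgue (\<lambda>x::real^'n. \<Prod>i\<in>UNIV. f i (x $ i))"
    and integral_lebesgue_prod:
      "(LINT x|lebesgue. (\<Prod>i\<in>UNIV. f i ((x::real^'n) $ i))) = (\<Prod>i\<in>UNIV. LINT t|lborel. f i t)"
proof -
  interpret product_sigma_finite "\<lambda>b::real^'n. lborel :: real measure" ..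
  have [measurable]: "f i \<in> borel_measurable borel" for i
    using f[of i] by auto
  have B: "(\<Sum>b\<in>Basis. y b *\<^sub>R b) \<bullet> b' = y b'" if "b' \<in> Basis" for y :: "real^'n \<Rightarrow> real" and b'
    using that by simp
  have m: "(\<lambda>x::real^'n. \<Prod>b\<in>Basis. f (axis_index b) (x \<bullet> b)) \<in> borel_measurable borel"
    by measurable
  have "integrable lborel (\<lambda>x::real^'n. \<Prod>b\<in>Basis. f (axis_index b) (x \<bullet> b))"
    by (subst lborel_eq, subst integrable_distr_eq)
       (auto simp: B f intro!: product_integrable_prod cong: prod.cong)
  then show "integrable lebesgue (\<lambda>x::real^'n. \<Prod>i\<in>UNIV. f i (x $ i))"
    using m by (simp add: integrable_completion prod_Basis_cart)
  have "(LINT x|lborel. (\<Prod>b\<in>Basis. f (axis_index b) ((x::real^'n) \<bullet> b)))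
      = (\<Prod>b\<in>(Basis::(real^'n) set). LINT t|lborel. f (axis_index b) t)"
    using product_integral_prod[of Basis "\<lambda>b. f (axis_index b)"]
    by (subst lborel_eq, subst integral_distr) (auto simp: B f cong: prod.cong)
  also have "\<dots> = (\<Prod>i\<in>UNIV. LINT t|lborel. f i t)"
    using prod_Basis_cart[of "\<lambda>i _. LINT t|lborel. f i t" "0::real^'n"] by simp
  finally show "(LINT x|lebesgue. (\<Prod>i\<in>UNIV. f i ((x::real^'n) $ i))) = (\<Prod>i\<in>UNIV. LINT t|lborel. f i t)"
    using m by (simp add: integral_completion prod_Basis_cart)
qed

text \<open>The one majorant for Schwartz functions and their transforms. With exponent n it lies
  below the product of the n one-dimensional functions 1/(1 + t^2), hence is integrable; being at
  most 1, it is also square integrable.\<close>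

definition decay_weight :: "real ^ 'n::finite \<Rightarrow> real" where
  "decay_weight x = inverse ((1 + (norm x)\<^sup>2) ^ CARD('n))"

lemma decay_weight_pos: "0 < decay_weight x"
  unfolding decay_weight_def by (simp add: add_pos_nonneg)

lemma decay_weight_nonneg[simp]: "0 \<le> decay_weight x"
  using decay_weight_pos[of x] by linarith

lemma decay_weight_le_1: "decay_weight x \<le> 1"
  unfolding decay_weight_def by (simp add: inverse_le_1_iff one_le_power)

lemma borel_measurable_decay_weight[measurable]: "decay_weight \<in> borel_measurable borel"
  unfolding decay_weight_def[abs_def] by measurable

lemma integrable_decay_weight: "integrable lebesgue (decay_weight :: real ^ 'n::finite \<Rightarrow> real)"
proof (rule Bochner_Integration.integrable_bound)
  show "integrable lebesgue (\<lambda>x::real^'n. \<Prod>i\<in>UNIV. inverse (1 + (x $ i)\<^sup>2))"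
    using integrable_inverse_1_plus_square
    by (intro integrable_lebesgue_prod[of "\<lambda>_ t. inverse (1 + t\<^sup>2)"])
       (simp add: set_integrable_def)
  show "decay_weight \<in> borel_measurable lebesgue"
    by (rule measurable_lebesgue_of_borel) simp
  have "norm (decay_weight x) \<le> norm (\<Prod>i\<in>UNIV. inverse (1 + (x $ i)\<^sup>2))" for x :: "real^'n"
  proof -
    have "(\<Prod>i\<in>UNIV. 1 + (x $ i)\<^sup>2) \<le> (\<Prod>i\<in>(UNIV::'n set). 1 + (norm x)\<^sup>2)"
      by (intro prod_mono) (auto simp: abs_le_square_iff[symmetric] component_le_norm_cart)
    moreover have "0 < (\<Prod>i\<in>UNIV. 1 + (x $ i)\<^sup>2)"
      by (intro prod_pos) (simp add: add_pos_nonneg)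
    ultimately show ?thesis
      using le_imp_inverse_le[of "\<Prod>i\<in>UNIV. 1 + (x $ i)\<^sup>2" "(1 + (norm x)\<^sup>2) ^ CARD('n)"]
      by (simp add: decay_weight_def prod_inversef[symmetric] order_trans[OF _ abs_ge_self])
  qed
  then show "AE x in lebesgue. norm (decay_weight x) \<le> norm (\<Prod>i\<in>UNIV. inverse (1 + ((x::real^'n) $ i)\<^sup>2))"
    by simp
qed

section \<open>Gaussians\<close>

lemma power2_norm_cart: "(norm x)\<^sup>2 = (\<Sum>i\<in>UNIV. (x $ i)\<^sup>2)" for x :: "real ^ 'n::finite"
  unfolding power2_norm_eq_inner inner_vec_def by (simp add: power2_eq_square)

lemma cis_sum: "cis (\<Sum>i\<in>A. f i) = (\<Prod>i\<in>A. cis (f i))"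
  by (induction A rule: infinite_finite_induct) (auto simp: cis_mult[symmetric])

lemma borel_measurable_cis[measurable]: "cis \<in> borel_measurable borel"
  unfolding cis_conv_exp[abs_def] by measurable

text \<open>Normalised so that its Fourier transform is \<open>gauss_kernel s\<close>, the density
  of independent centred normal coordinates with standard deviation \<open>s\<close>. As
  \<open>s\<close> tends to 0 the multiplier tends to 1 and the kernel concentrates at the
  origin.\<close>

definition gauss :: "real \<Rightarrow> real ^ 'n::finite \<Rightarrow> real" where
  "gauss s \<xi> = exp (- (2 * pi\<^sup>2 * s\<^sup>2 * (norm \<xi>)\<^sup>2))"

definition gauss_kernel :: "real \<Rightarrow> real ^ 'n::finite \<Rightarrow> real" where
  "gauss_kernel s y = (\<Prod>i\<in>UNIV. normal_density 0 s (y $ i))"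

lemma gauss_prod: "gauss s \<xi> = (\<Prod>i\<in>UNIV. exp (- (2 * pi\<^sup>2 * s\<^sup>2 * (\<xi> $ i)\<^sup>2)))"
  unfolding gauss_def power2_norm_cart
  by (simp add: exp_sum[symmetric] sum_negf sum_distrib_left)

lemma gauss_pos[simp]: "0 < gauss s \<xi>" and gauss_nonneg[simp]: "0 \<le> gauss s \<xi>"
  and gauss_le_1: "gauss s \<xi> \<le> 1"
  by (auto simp: gauss_def)

lemma borel_measurable_gauss[measurable]: "gauss s \<in> borel_measurable borel"
  unfolding gauss_def[abs_def] by measurable

lemma borel_measurable_gauss_kernel[measurable]: "gauss_kernel s \<in> borel_measurable borel"
  unfolding gauss_kernel_def[abs_def] by measurable

lemma integrable_gauss_1:
  assumes "0 < s" shows "integrable lborel (\<lambda>t::real. exp (- (2 * pi\<^sup>2 * s\<^sup>2 * t\<^sup>2)))"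
proof -
  let ?\<sigma> = "1 / (2 * pi * s)"
  have "integrable lborel (\<lambda>t. sqrt (2 * pi * ?\<sigma>\<^sup>2) * normal_density 0 ?\<sigma> t)"
    using assms by (intro integrable_mult_right integrable_normal_density) simp
  also have "(\<lambda>t. sqrt (2 * pi * ?\<sigma>\<^sup>2) * normal_density 0 ?\<sigma> t) = (\<lambda>t. exp (- (2 * pi\<^sup>2 * s\<^sup>2 * t\<^sup>2)))"
    using assms by (auto simp: normal_density_def fun_eq_iff field_simps power2_eq_square)
  finally show ?thesis .
qed

text \<open>The substitution t = r / (2 pi s) turns the integral into the characteristic function of
  the standard normal distribution at -y/s; the Jacobian supplies the normalising constant of the
  density.\<close>

lemma fourier_gauss_1:
  assumes s: "0 < s"
  shows "(LINT t|lborel. cis (- 2 * pi * (t * y)) * of_real (exp (- (2 * pi\<^sup>2 * s\<^sup>2 * t\<^sup>2)))) = of_real (normal_density 0 s y)"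
proof -
  let ?f = "\<lambda>t. cis (- 2 * pi * (t * y)) * of_real (exp (- (2 * pi\<^sup>2 * s\<^sup>2 * t\<^sup>2)))"
  let ?c = "1 / (2 * pi * s)"
  have f: "?f (0 + ?c * t) = of_real (sqrt (2 * pi)) * (std_normal_density t *\<^sub>R iexp (- (y / s) * t))" for t
  proof -
    have "- (2 * pi\<^sup>2 * s\<^sup>2 * (?c * t)\<^sup>2) = - t\<^sup>2 / 2" "- 2 * pi * (?c * t * y) = - (y / s) * t"
      using s by (simp_all add: power2_eq_square)
    then show ?thesis
      unfolding add_0 cis_conv_exp
      by (simp only: std_normal_density_def scaleR_conv_of_real of_real_mult)
        (simp add: exp_of_real)
  qed
  have "(LINT t|lborel. ?f t) = \<bar>?c\<bar> *\<^sub>R (LINT t|lborel. ?f (0 + ?c * t))"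
    using s by (intro lborel_integral_real_affine) simp
  also have "\<dots> = of_real (?c * sqrt (2 * pi)) * (LINT t|lborel. std_normal_density t *\<^sub>R iexp (- (y / s) * t))"
    using s unfolding f by (subst integral_mult_right_zero) (simp add: scaleR_conv_of_real)
  also have "(LINT t|lborel. std_normal_density t *\<^sub>R iexp (- (y / s) * t)) = char std_normal_distribution (- (y / s))"
    unfolding char_def by (subst integral_density) auto
  also have "of_real (?c * sqrt (2 * pi)) * \<dots> = of_real (normal_density 0 s y)"
  proof -
    have "sqrt (2 * pi) * sqrt (2 * pi) = 2 * pi" by simp
    then have "?c * sqrt (2 * pi) = 1 / (sqrt (2 * pi) * s)"
      using s by (simp add: field_simps)
    then have "?c * sqrt (2 * pi) = 1 / sqrt (2 * pi * s\<^sup>2)"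
      using s by (simp add: real_sqrt_mult)
    moreover have "- (- (y / s))\<^sup>2 / 2 = - (y - 0)\<^sup>2 / (2 * s\<^sup>2)"
      by (simp add: power_divide)
    ultimately show ?thesis
      by (simp only: char_std_normal_distribution normal_density_def[of 0 s y] of_real_mult)
  qed
  finally show ?thesis .
qed

lemma integrable_fourier_kernel:
  fixes a :: "'a::euclidean_space \<Rightarrow> real"
  assumes "integrable lebesgue f"
  assumes [measurable]: "a \<in> borel_measurable lebesgue"
  shows "integrable lebesgue (\<lambda>x. cis (a x) * f x)"
proof -
  have [measurable]: "f \<in> borel_measurable lebesgue" using assms(1) by auto
  show ?thesis
    using assms(1) by (rule Bochner_Integration.integrable_bound) (auto simp: norm_mult)
qed

lemma
  assumes s: "0 < s"
  shows integrable_gauss: "integrable lebesgue (gauss s :: real ^ 'n::finite \<Rightarrow> real)"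
    and fourier_gauss: "fourier (\<lambda>\<xi>::real^'n. of_real (gauss s \<xi>)) y = of_real (gauss_kernel s y)"
proof -
  show "integrable lebesgue (gauss s :: real ^ 'n::finite \<Rightarrow> real)"
    unfolding gauss_prod[abs_def] by (intro integrable_lebesgue_prod integrable_gauss_1 s)
  have *: "cis (- 2 * pi * (x \<bullet> y)) * of_real (gauss s x) =
      (\<Prod>i\<in>UNIV. cis (- 2 * pi * (x $ i * y $ i)) * of_real (exp (- (2 * pi\<^sup>2 * s\<^sup>2 * (x $ i)\<^sup>2))))" for x
    unfolding gauss_prod inner_vec_def inner_real_def sum_distrib_left cis_sum prod.distrib of_real_prod ..
  have "integrable lborel (\<lambda>t. cis (- 2 * pi * (t * y $ i)) * of_real (exp (- (2 * pi\<^sup>2 * s\<^sup>2 * t\<^sup>2))))" for i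
    by (rule Bochner_Integration.integrable_bound[OF integrable_gauss_1[OF s]])
       (auto simp: norm_mult)
  then show "fourier (\<lambda>\<xi>::real^'n. of_real (gauss s \<xi>)) y = of_real (gauss_kernel s y)"
    unfolding fourier_def * 
    by (subst integral_lebesgue_prod)
       (simp_all add: fourier_gauss_1[OF s, unfolded mult_minus_left] gauss_kernel_def del: of_real_exp)
qed

lemma gauss_kernel_nonneg[simp]: "0 \<le> gauss_kernel s y"
  unfolding gauss_kernel_def by (intro prod_nonneg) simp

lemma
  assumes s: "0 < s"
  shows integrable_gauss_kernel: "integrable lebesgue (gauss_kernel s :: real ^ 'n::finite \<Rightarrow> real)"
    and integral_gauss_kernel: "(LINT y|lebesgue. gauss_kernel s (y :: real ^ 'n::finite)) = 1"
  unfolding gauss_kernel_def[abs_def]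
  using integrable_lebesgue_prod[of "\<lambda>_. normal_density 0 s"] integral_lebesgue_prod[of "\<lambda>_. normal_density 0 s"] s
  by auto

text \<open>After the substitution y = x + s z the kernel no longer depends on \<open>s\<close>, so
  the limit \<open>s\<close> to 0 acts on the averaged function alone.\<close>

lemma gauss_kernel_scale:
  fixes z :: "real ^ 'n::finite"
  assumes "0 < s"
  shows "gauss_kernel s (s *\<^sub>R z) * s ^ CARD('n) = gauss_kernel 1 z"
proof -
  have "normal_density 0 s (s * t) * s = normal_density 0 1 t" for t
    using assms by (simp add: normal_density_def real_sqrt_mult power_mult_distrib)
  then have "(\<Prod>i\<in>(UNIV::'n set). normal_density 0 s (s * z $ i) * s) = (\<Prod>i\<in>UNIV. normal_density 0 1 (z $ i))"
    by simp
  then show ?thesis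
    by (simp add: gauss_kernel_def prod.distrib del: prod_constant) simp
qed

text \<open>Unit mass in each variable separately: the two marginal conditions of the Schur test in
  \<open>gauss_kernel_schur\<close>.\<close>

lemma nn_integral_gauss_kernel:
  assumes "0 < s"
  shows "(\<integral>\<^sup>+ y. ennreal (gauss_kernel s (y - x)) \<partial>lebesgue) = 1"
    and "(\<integral>\<^sup>+ x. ennreal (gauss_kernel s (y - x)) \<partial>lebesgue) = 1"
proof -
  have 1: "(\<integral>\<^sup>+ y. ennreal (gauss_kernel s y) \<partial>lebesgue) = 1"
    using integrable_gauss_kernel[OF assms] integral_gauss_kernel[OF assms]
    by (subst nn_integral_eq_integral) auto
  have m: "(\<lambda>y. ennreal (gauss_kernel s y)) \<in> borel_measurable lebesgue"
    by (rule measurable_lebesgue_of_borel) measurable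
  show "(\<integral>\<^sup>+ y. ennreal (gauss_kernel s (y - x)) \<partial>lebesgue) = 1"
    using nn_integral_lebesgue_affine[of 1 _ "-x", OF _ m] by (simp add: 1)
  show "(\<integral>\<^sup>+ x. ennreal (gauss_kernel s (y - x)) \<partial>lebesgue) = 1"
    using nn_integral_lebesgue_affine[of "-1" _ y, OF _ m] by (simp add: 1)
qed

lemma tendsto_gauss: "(\<lambda>k. gauss (s k) \<xi>) \<longlonglongrightarrow> 1" if "s \<longlonglongrightarrow> 0"
  unfolding gauss_def by (rule tendsto_eq_intros that refl | simp)+

section \<open>Schwartz functions\<close>

lemma partial_eqI: "(f has_derivative D) (at x) \<Longrightarrow> partial i f x = D (axis i 1)"
  unfolding partial_def using frechet_derivative_at by metis

lemma partials_Nil[simp]: "partials [] f = f"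
  and partials_Cons[simp]: "partials (i # js) f = partial i (partials js f)"
  and partials_append: "partials (is @ js) f = partials is (partials js f)"
  by (simp_all add: partials_def)

lemma schwartz_differentiable: "schwartz f \<Longrightarrow> f differentiable (at x)"
  unfolding schwartz_def by (metis partials_Nil)

lemma schwartz_partials_differentiable: "schwartz f \<Longrightarrow> partials js f differentiable (at x)"
  unfolding schwartz_def by metis

lemma schwartz_decay: "schwartz f \<Longrightarrow> \<exists>C. \<forall>x. norm x ^ k * norm (f x) \<le> C"
  unfolding schwartz_def by (metis partials_Nil)

lemma schwartz_partials: "schwartz f \<Longrightarrow> schwartz (partials js f)"
  unfolding schwartz_def partials_append[symmetric] by blast

lemma schwartz_partial: "schwartz f \<Longrightarrow> schwartz (partial i f)"
  using schwartz_partials[of f "[i]"] by simp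

lemma schwartz_has_derivative:
  "schwartz f \<Longrightarrow> (f has_derivative frechet_derivative f (at x)) (at x)"
  using schwartz_differentiable frechet_derivative_works by blast

text \<open>Replaces formulas for iterated derivatives: a class closed under \<open>partial\<close>
  contains all of them, by induction on the list of directions, so differentiability and decay need
  checking only for members of the class.\<close>

lemma schwartz_of_closed_class:
  assumes "f \<in> S"
    and "\<And>g x. g \<in> S \<Longrightarrow> g differentiable (at x)"
    and "\<And>g i. g \<in> S \<Longrightarrow> partial i g \<in> S"
    and "\<And>g k. g \<in> S \<Longrightarrow> \<exists>C. \<forall>x. norm x ^ k * norm (g x) \<le> C"
  shows "schwartz f"
proof -
  have "partials js f \<in> S" for js
    by (induction js) (auto intro: assms)
  then show ?thesis
    using assms(2,4) unfolding schwartz_def by blast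
qed

lemma partial_add:
  assumes "f differentiable (at x)" "g differentiable (at x)"
  shows "partial i (\<lambda>x. f x + g x) x = partial i f x + partial i g x"
  using assms[unfolded frechet_derivative_works]
  by (subst partial_eqI[OF has_derivative_add]) (auto simp: partial_def)

lemma partial_mult:
  assumes "f differentiable (at x)" "g differentiable (at x)"
  shows "partial i (\<lambda>x. f x * g x) x = f x * partial i g x + partial i f x * g x"
  using assms[unfolded frechet_derivative_works]
  by (subst partial_eqI[OF has_derivative_mult]) (auto simp: partial_def)

lemma has_derivative_exp_comp:
  fixes g :: "'a::real_normed_vector \<Rightarrow> complex"
  assumes "(g has_derivative g') (at x)"
  shows "((\<lambda>x. exp (g x)) has_derivative (\<lambda>h. exp (g x) * g' h)) (at x)"
  using has_derivative_compose[OF assms, of exp "\<lambda>h. exp (g x) * h"] DERIV_exp[of "g x"]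
  by (simp add: has_field_derivative_def)

lemma partial_exp:
  assumes "f differentiable (at x)"
  shows "partial i (\<lambda>x. exp (f x)) x = partial i f x * exp (f x)"
  using assms[unfolded frechet_derivative_works]
  by (subst partial_eqI[OF has_derivative_exp_comp]) (auto simp: partial_def)

lemma differentiable_exp_comp:
  fixes f :: "'a::real_normed_vector \<Rightarrow> complex"
  shows "f differentiable (at x) \<Longrightarrow> (\<lambda>x. exp (f x)) differentiable (at x)"
  using has_derivative_exp_comp unfolding differentiable_def by blast

section \<open>Polynomials and exponentials of polynomials\<close>

inductive cpoly :: "(real ^ 'n::finite \<Rightarrow> complex) \<Rightarrow> bool" where
  cpoly_const: "cpoly (\<lambda>_. c)"
| cpoly_coord: "cpoly (\<lambda>x. of_real (x $ i))"
| cpoly_add: "cpoly p \<Longrightarrow> cpoly q \<Longrightarrow> cpoly (\<lambda>x. p x + q x)"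
| cpoly_mult: "cpoly p \<Longrightarrow> cpoly q \<Longrightarrow> cpoly (\<lambda>x. p x * q x)"

lemma cpoly_sum: "(\<And>i. i \<in> A \<Longrightarrow> cpoly (p i)) \<Longrightarrow> cpoly (\<lambda>x. \<Sum>i\<in>A. p i x)"
  by (induction A rule: infinite_finite_induct) (auto intro: cpoly.intros)

lemma cpoly_power: "cpoly p \<Longrightarrow> cpoly (\<lambda>x. p x ^ k)"
  by (induction k) (auto intro: cpoly.intros)

lemma has_derivative_coord:
  "((\<lambda>x. of_real (x $ i) :: complex) has_derivative (\<lambda>h. of_real (h $ i))) (at x)"
  by (rule bounded_linear_imp_has_derivative)
     (rule bounded_linear_compose[OF bounded_linear_of_real bounded_linear_vec_nth])

text \<open>Both claims go through one induction because the sum and product rules for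
  \<open>partial\<close> require differentiability of the parts.\<close>

lemma cpoly_partial_closed:
  fixes p :: "real ^ 'n::finite \<Rightarrow> complex"
  shows "cpoly p \<Longrightarrow> (\<forall>x. p differentiable (at x)) \<and> (\<forall>i. cpoly (partial i p))"
proof (induction rule: cpoly.induct)
  case (cpoly_const c)
  have "partial i (\<lambda>_. c) = (\<lambda>_. 0)" for i :: 'n
    by (auto simp: fun_eq_iff intro: partial_eqI)
  then show ?case by (auto intro: cpoly.cpoly_const)
next
  case (cpoly_coord j)
  have "partial i (\<lambda>x. of_real (x $ j)) = (\<lambda>_. of_real (axis i 1 $ j))" for i
    by (auto simp: fun_eq_iff intro!: partial_eqI[OF has_derivative_coord])
  then show ?case using has_derivative_coord 
    by (auto intro: cpoly.cpoly_const simp: differentiable_def)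
next
  case (cpoly_add p q)
  then have "partial i (\<lambda>x. p x + q x) = (\<lambda>x. partial i p x + partial i q x)" for i
    by (auto simp: fun_eq_iff partial_add)
  with cpoly_add show ?case by (auto intro: cpoly.intros)
next
  case (cpoly_mult p q)
  then have "partial i (\<lambda>x. p x * q x) = (\<lambda>x. p x * partial i q x + partial i p x * q x)" for i
    by (auto simp: fun_eq_iff partial_mult)
  with cpoly_mult show ?case by (auto intro!: cpoly.intros differentiable_mult)
qed

lemma cpoly_differentiable: "cpoly p \<Longrightarrow> p differentiable (at x)"
  and cpoly_partial: "cpoly p \<Longrightarrow> cpoly (partial i p)"
  using cpoly_partial_closed by auto

lemma cpoly_growth: "cpoly p \<Longrightarrow> \<exists>C N. \<forall>x. norm (p x) \<le> C * (1 + norm x) ^ N"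
proof (induction rule: cpoly.induct)
  case (cpoly_const c)
  have "norm c \<le> norm c * (1 + norm x) ^ 0" for x by simp
  then show ?case by blast
next
  case (cpoly_coord i)
  have "norm (complex_of_real (x $ i)) \<le> 1 * (1 + norm x) ^ 1" for x
    using component_le_norm_cart[of x i] by simp
  then show ?case by blast
next
  case (cpoly_add p q)
  then obtain C N D M where *: "\<And>x. norm (p x) \<le> C * (1 + norm x) ^ N" "\<And>x. norm (q x) \<le> D * (1 + norm x) ^ M"
    by blast
  \<comment> \<open>Both bounds are raised to the common exponent \<open>N + M\<close>, since
    \<open>1 + norm x\<close> is at least 1; the absolute values avoid a sign argument for the
    constants.\<close>
  have "norm (p x + q x) \<le> (\<bar>C\<bar> + \<bar>D\<bar>) * (1 + norm x) ^ (N + M)" for x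
  proof -
    have "norm (p x) \<le> \<bar>C\<bar> * (1 + norm x) ^ (N + M)"
      using *(1)[of x] by (rule order_trans) (auto intro!: mult_mono power_increasing)
    moreover have "norm (q x) \<le> \<bar>D\<bar> * (1 + norm x) ^ (N + M)"
      using *(2)[of x] by (rule order_trans) (auto intro!: mult_mono power_increasing)
    ultimately show ?thesis
      using norm_triangle_ineq[of "p x" "q x"] by (simp add: distrib_right)
  qed
  then show ?case by blast
next
  case (cpoly_mult p q)
  then obtain C N D M where *: "\<And>x. norm (p x) \<le> C * (1 + norm x) ^ N" "\<And>x. norm (q x) \<le> D * (1 + norm x) ^ M"
    by blast
  have "norm (p x * q x) \<le> (C * D) * (1 + norm x) ^ (N + M)" for x
    using mult_mono[OF *(1)[of x] *(2)[of x]] *(1)[of x] norm_ge_zero[of "p x"]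
    by (simp add: norm_mult power_add algebra_simps)
  then show ?case by blast
qed

text \<open>The sums needed to close \<open>exp P * f\<close> under differentiation: a derivative of
  a generator changes its polynomial factor to q' + q P' or adds one more partial derivative to
  \<open>f\<close>.\<close>

inductive exp_class :: "(real ^ 'n::finite \<Rightarrow> complex) \<Rightarrow> (real ^ 'n \<Rightarrow> complex) \<Rightarrow> (real ^ 'n \<Rightarrow> complex) \<Rightarrow> bool"
  for P f where
  exp_class_base: "cpoly q \<Longrightarrow> exp_class P f (\<lambda>x. q x * (exp (P x) * partials js f x))"
| exp_class_add: "exp_class P f g \<Longrightarrow> exp_class P f h \<Longrightarrow> exp_class P f (\<lambda>x. g x + h x)"

text \<open>Boundedness is assumed for the whole product, not for its factors, so that decay may
  come from either one: from \<open>f\<close> for chirps, where the exponential is unimodular, and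
  from the exponential for \<open>box_bump\<close>, where \<open>f\<close> is the constant
  1.\<close>

lemma schwartz_exp_mult:
  fixes f :: "real ^ 'n::finite \<Rightarrow> complex"
  assumes P: "cpoly P"
    and f: "\<And>js x. partials js f differentiable (at x)"
    and b: "\<And>q js. cpoly q \<Longrightarrow> \<exists>C. \<forall>x. norm (q x * (exp (P x) * partials js f x)) \<le> C"
  shows "schwartz (\<lambda>x. exp (P x) * f x)"
proof (rule schwartz_of_closed_class[where S="Collect (exp_class P f)"])
  show "(\<lambda>x. exp (P x) * f x) \<in> Collect (exp_class P f)"
    using exp_class_base[OF cpoly_const[of 1], of P f "[]"] by simp
next
  fix g x assume "g \<in> Collect (exp_class P f)"
  then have "exp_class P f g" by simp
  then show "g differentiable (at x)"
    by induction (simp_all add: differentiable_mult differentiable_exp_comp f cpoly_differentiable P)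
next
  fix g i assume "g \<in> Collect (exp_class P f)"
  then have "exp_class P f g" by simp
  then have "(\<forall>x. g differentiable (at x)) \<and> exp_class P f (partial i g)"
  proof induction
    case (exp_class_base q js)
    have "partial i (\<lambda>x. q x * (exp (P x) * partials js f x)) =
      (\<lambda>x. (partial i q x + q x * partial i P x) * (exp (P x) * partials js f x)
         + q x * (exp (P x) * partials (i # js) f x))"
      using exp_class_base P f
      by (auto simp: fun_eq_iff partial_mult partial_exp differentiable_mult differentiable_exp_comp
        cpoly_differentiable algebra_simps)
    moreover have "exp_class P f (\<lambda>x. (partial i q x + q x * partial i P x) * (exp (P x) * partials js f x)
         + q x * (exp (P x) * partials (i # js) f x))"
      by (rule exp_class.exp_class_add; rule exp_class.exp_class_base)
         (intro cpoly.intros cpoly_partial P exp_class_base)+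
    ultimately show ?case
      using exp_class_base by (simp add: differentiable_mult differentiable_add differentiable_exp_comp
        cpoly_differentiable P f)
  next
    case (exp_class_add g h)
    then have "partial i (\<lambda>x. g x + h x) = (\<lambda>x. partial i g x + partial i h x)"
      by (auto simp: fun_eq_iff partial_add)
    with exp_class_add show ?case by (auto intro: exp_class.intros)
  qed
  then show "partial i g \<in> Collect (exp_class P f)" by simp
next
  fix g and k :: nat assume "g \<in> Collect (exp_class P f)"
  then have "exp_class P f g" by simp
  \<comment> \<open>Quantifying over all polynomial weights makes the induction work, as the
    polynomial factor of a generator is absorbed into the weight.\<close>
  then have "\<exists>C. \<forall>x. norm (q x * g x) \<le> C" if "cpoly q" for q
  proof induction
    case (exp_class_base p js)
    show ?case
      using b[OF cpoly_mult[OF that exp_class_base], of js] by (simp add: mult.assoc)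
  next
    case (exp_class_add g h)
    then obtain C D where "\<And>x. norm (q x * g x) \<le> C" "\<And>x. norm (q x * h x) \<le> D" by blast
    then have "norm (q x * (g x + h x)) \<le> C + D" for x
      unfolding distrib_left by (rule norm_triangle_mono)
    then show ?case by blast
  qed
  \<comment> \<open>Powers of the norm need not be polynomials; (1 + |x|^2)^k is one and dominates
    |x|^k.\<close>
  moreover have "cpoly (\<lambda>x::real^'n. (1 + (\<Sum>i\<in>UNIV. of_real (x $ i) ^ 2)) ^ k)"
    by (intro cpoly_power cpoly_add cpoly_sum cpoly_const cpoly_coord)
  ultimately obtain C where C: "\<And>x. norm ((1 + (\<Sum>i\<in>UNIV. of_real (x $ i) ^ 2)) ^ k * g x) \<le> C"
    by blast
  have "norm x ^ k * norm (g x) \<le> C" for x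
  proof -
    have "1 + (\<Sum>i\<in>UNIV. of_real (x $ i) ^ 2) = complex_of_real (1 + (norm x)\<^sup>2)"
      by (simp add: power2_norm_cart)
    then have eq: "norm ((1 + (\<Sum>i\<in>UNIV. of_real (x $ i) ^ 2)) ^ k * g x) = (1 + (norm x)\<^sup>2) ^ k * norm (g x)"
      by (simp only: norm_mult norm_power norm_of_real) simp
    moreover have "norm x \<le> 1 + (norm x)\<^sup>2"
      using zero_le_power2[of "norm x - 1"] norm_ge_zero[of x]
      unfolding power2_diff by (simp, linarith)
    ultimately have "norm x ^ k * norm (g x) \<le> (1 + (norm x)\<^sup>2) ^ k * norm (g x)"
      by (intro mult_right_mono power_mono) auto
    then show ?thesis
      using C[of x] eq by simp
  qed
  then show "\<exists>C. \<forall>x. norm x ^ k * norm (g x) \<le> C" by blast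
qed

lemma one_plus_power_le:
  fixes a :: real
  assumes "0 \<le> a"
  shows "(1 + a) ^ N \<le> 2 ^ N * (1 + a ^ N)"
proof (cases "a \<le> 1")
  case True
  then have "(1 + a) ^ N \<le> 2 ^ N * 1" using assms by (simp add: power_mono)
  also have "\<dots> \<le> 2 ^ N * (1 + a ^ N)" using assms by (intro mult_left_mono) auto
  finally show ?thesis .
next
  case False
  then have "(1 + a) ^ N \<le> (2 * a) ^ N" by (intro power_mono) auto
  also have "\<dots> \<le> 2 ^ N * (1 + a ^ N)" by (simp add: power_mult_distrib)
  finally show ?thesis .
qed

lemma schwartz_poly_bound:
  assumes "schwartz f" "cpoly q"
  shows "\<exists>C. \<forall>x. norm (q x * f x) \<le> C"
proof -
  obtain C N where C: "\<And>x. norm (q x) \<le> C * (1 + norm x) ^ N"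
    using cpoly_growth[OF assms(2)] by blast
  obtain D0 where D0: "\<And>x. norm (f x) \<le> D0"
    using schwartz_decay[OF assms(1), of 0] by auto
  obtain D where D: "\<And>x. norm x ^ N * norm (f x) \<le> D"
    using schwartz_decay[OF assms(1), of N] by auto
  have "norm (q x * f x) \<le> \<bar>C\<bar> * (2 ^ N * (D0 + D))" for x
  proof -
    have "(1 + norm x) ^ N \<le> 2 ^ N * (1 + norm x ^ N)"
      by (rule one_plus_power_le) simp
    then have "(1 + norm x) ^ N * norm (f x) \<le> 2 ^ N * (1 + norm x ^ N) * norm (f x)"
      by (rule mult_right_mono) simp
    also have "\<dots> \<le> 2 ^ N * (D0 + D)"
      using mult_left_mono[OF add_mono[OF D0[of x] D[of x]], of "2 ^ N"] by (simp add: algebra_simps)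
    finally have 1: "(1 + norm x) ^ N * norm (f x) \<le> 2 ^ N * (D0 + D)" .
    have "norm (q x) \<le> \<bar>C\<bar> * (1 + norm x) ^ N"
      using C[of x] by (rule order_trans) (simp add: mult_right_mono)
    then have "norm (q x * f x) \<le> \<bar>C\<bar> * (1 + norm x) ^ N * norm (f x)"
      by (simp add: norm_mult mult_right_mono)
    also have "\<dots> \<le> \<bar>C\<bar> * (2 ^ N * (D0 + D))"
      using mult_left_mono[OF 1, of "\<bar>C\<bar>"] by (simp add: mult.assoc)
    finally show ?thesis .
  qed
  then show ?thesis by blast
qed

text \<open>The exponent is an imaginary polynomial. Its derivatives contribute polynomial factors
  only, and these are absorbed by the decay of the derivatives of \<open>f\<close>.\<close>

lemma schwartz_cis_mult:
  fixes f :: "real ^ 'n::finite \<Rightarrow> complex"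
  assumes "schwartz f"
  shows "schwartz (\<lambda>x. cis (a * (norm x)\<^sup>2) * f x)"
proof -
  let ?P = "\<lambda>x::real^'n. (\<i> * of_real a) * (\<Sum>i\<in>UNIV. of_real (x $ i) ^ 2)"
  have P: "?P x = \<i> * of_real (a * (norm x)\<^sup>2)" for x
    by (simp add: power2_norm_cart)
  have "schwartz (\<lambda>x. exp (?P x) * f x)"
  proof (rule schwartz_exp_mult)
    show "cpoly ?P"
      by (intro cpoly_mult cpoly_const cpoly_power cpoly_sum cpoly_coord)
    show "\<exists>C. \<forall>x. norm (q x * (exp (?P x) * partials js f x)) \<le> C" if "cpoly q" for q js
      using schwartz_poly_bound[OF schwartz_partials[OF assms] that, of js]
      unfolding P norm_mult cis_conv_exp[symmetric] by (simp add: norm_mult)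
  qed (simp add: schwartz_partials_differentiable assms)
  then show ?thesis unfolding P cis_conv_exp[symmetric] .
qed

lemma schwartz_chirp: "schwartz f \<Longrightarrow> schwartz (chirp \<alpha> f)"
  using schwartz_cis_mult[of f "pi * cot \<alpha>"] by (simp add: chirp_def[abs_def] mult_ac)

lemma schwartz_inv_chirp: "schwartz f \<Longrightarrow> schwartz (inv_chirp \<alpha> f)"
  using schwartz_cis_mult[of f "- pi * cot \<alpha>"] by (simp add: inv_chirp_def[abs_def] mult_ac)

lemma schwartz_add:
  assumes "schwartz f" "schwartz g"
  shows "schwartz (\<lambda>x. f x + g x)"
proof (rule schwartz_of_closed_class[where S="{\<lambda>x. f x + g x |f g. schwartz f \<and> schwartz g}"])
  show "\<exists>C. \<forall>x. norm x ^ k * norm (h x) \<le> C"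
    if h: "h \<in> {\<lambda>x. f x + g x |f g. schwartz f \<and> schwartz g}" for h and k
  proof -
    obtain f g where h: "h = (\<lambda>x. f x + g x)" "schwartz f" "schwartz g" using h by blast
    obtain C D where "\<And>x. norm x ^ k * norm (f x) \<le> C" "\<And>x. norm x ^ k * norm (g x) \<le> D"
      using schwartz_decay h(2,3) by metis
    then have "norm x ^ k * norm (h x) \<le> C + D" for x
      unfolding h(1)
      by (intro order_trans[OF mult_left_mono[OF norm_triangle_ineq]]) (auto simp: distrib_left intro: add_mono)
    then show ?thesis by blast
  qed
  show "partial i h \<in> {\<lambda>x. f x + g x |f g. schwartz f \<and> schwartz g}"
    if h: "h \<in> {\<lambda>x. f x + g x |f g. schwartz f \<and> schwartz g}" for h i
  proof -
    obtain f g where h: "h = (\<lambda>x. f x + g x)" "schwartz f" "schwartz g" using h by blast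
    have "partial i h = (\<lambda>x. partial i f x + partial i g x)"
      unfolding h(1) fun_eq_iff using h(2,3) by (simp add: partial_add schwartz_differentiable)
    then show ?thesis using h schwartz_partial by blast
  qed
qed (use assms schwartz_differentiable in \<open>auto intro!: differentiable_add\<close>)

lemma schwartz_zero: "schwartz (\<lambda>_. 0)"
proof -
  have "partials js (\<lambda>_. 0) = (\<lambda>_. 0)" for js :: "'a list"
    by (induction js) (auto simp: fun_eq_iff intro: partial_eqI)
  then show ?thesis by (auto simp: schwartz_def)
qed

lemma schwartz_cmult:
  assumes "schwartz f"
  shows "schwartz (\<lambda>x. c * f x)"
proof (rule schwartz_of_closed_class[where S="{\<lambda>x. c * f x |f. schwartz f}"])
  show "\<exists>C. \<forall>x. norm x ^ k * norm (h x) \<le> C"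
    if h: "h \<in> {\<lambda>x. c * f x |f. schwartz f}" for h and k
  proof -
    obtain f where h: "h = (\<lambda>x. c * f x)" "schwartz f" using h by blast
    obtain C where "\<And>x. norm x ^ k * norm (f x) \<le> C"
      using schwartz_decay h(2) by metis
    then have "norm x ^ k * norm (h x) \<le> norm c * C" for x
      using mult_left_mono[of "norm x ^ k * norm (f x)" C "norm c"] by (simp add: h norm_mult algebra_simps)
    then show ?thesis by blast
  qed
  show "partial i h \<in> {\<lambda>x. c * f x |f. schwartz f}"
    if h: "h \<in> {\<lambda>x. c * f x |f. schwartz f}" for h i
  proof -
    obtain f where h: "h = (\<lambda>x. c * f x)" "schwartz f" using h by blast
    have "partial i (\<lambda>_. c) x = 0" for x
      by (auto intro: partial_eqI)
    then have "partial i h = (\<lambda>x. c * partial i f x)"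
      unfolding h(1) fun_eq_iff using h(2) by (simp add: partial_mult schwartz_differentiable)
    then show ?thesis using h schwartz_partial by blast
  qed
qed (use assms schwartz_differentiable in \<open>auto intro!: differentiable_mult\<close>)

section \<open>Decay of Fourier transforms of Schwartz functions\<close>

text \<open>Two of the assumed bounds suffice, those of order 0 and 2n, because (1 + |x|^2)^n is at
  most 2^n (1 + |x|^(2n)).\<close>

lemma decay_weight_bound:
  fixes f :: "real ^ 'n::finite \<Rightarrow> complex"
  assumes "\<And>k. \<exists>C. \<forall>x. norm x ^ k * norm (f x) \<le> C"
  shows "\<exists>C\<ge>0. \<forall>x. norm (f x) \<le> C * decay_weight x"
proof -
  obtain D0 where D0: "\<And>x. norm (f x) \<le> D0"
    using assms[of 0] by auto
  obtain D where D: "\<And>x. norm x ^ (2 * CARD('n)) * norm (f x) \<le> D"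
    using assms by blast
  have D: "((norm x)\<^sup>2) ^ CARD('n) * norm (f x) \<le> D" for x
    using D[of x] by (simp only: power_mult)
  have "norm (f x) \<le> (2 ^ CARD('n) * (D0 + D)) * decay_weight x" for x
  proof -
    have "(1 + (norm x)\<^sup>2) ^ CARD('n) * norm (f x) \<le> 2 ^ CARD('n) * (1 + (norm x)\<^sup>2 ^ CARD('n)) * norm (f x)"
      by (intro mult_right_mono one_plus_power_le) auto
    also have "\<dots> \<le> 2 ^ CARD('n) * (D0 + D)"
      using mult_left_mono[OF add_mono[OF D0[of x] D[of x]], of "2 ^ CARD('n)"]
      by (simp add: algebra_simps)
    finally show ?thesis
      unfolding decay_weight_def by (simp add: field_simps add_pos_nonneg)
  qed
  moreover have "0 \<le> D0 + D"
    using order_trans[OF norm_ge_zero D0[of 0]] D[of 0] by (simp add: power_0_left)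
  ultimately show ?thesis
    by (intro exI[of _ "2 ^ CARD('n) * (D0 + D)"]) simp
qed

text \<open>A shift by at most one unit costs a constant factor, since 1 + |x|^2 is at most 3 + 2 |x
  + y|^2. Hence a single majorant serves difference quotients of all steps up to 1.\<close>

lemma decay_weight_translate:
  fixes x :: "real ^ 'n::finite"
  assumes "norm y \<le> 1"
  shows "decay_weight (x + y) \<le> 3 ^ CARD('n) * decay_weight x"
proof -
  have "norm x \<le> norm (x + y) + norm y"
    using norm_triangle_ineq4[of "x + y" y] by simp
  then have "(norm x)\<^sup>2 \<le> (norm (x + y) + 1)\<^sup>2"
    using assms by (intro power_mono) auto
  also have "\<dots> \<le> 2 * (norm (x + y))\<^sup>2 + 2"
    using sum_squares_ge_zero[of "norm (x + y) - 1" 0] by (simp add: power2_eq_square algebra_simps)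
  finally have "1 + (norm x)\<^sup>2 \<le> 3 * (1 + (norm (x + y))\<^sup>2)"
    using zero_le_power2[of "norm (x + y)"] by (simp, linarith)
  then have "(1 + (norm x)\<^sup>2) ^ CARD('n) \<le> 3 ^ CARD('n) * (1 + (norm (x + y))\<^sup>2) ^ CARD('n)"
    unfolding power_mult_distrib[symmetric] by (rule power_mono) simp
  then show ?thesis
    unfolding decay_weight_def by (simp add: field_simps add_pos_nonneg)
qed

lemma schwartz_weight_bound: "schwartz f \<Longrightarrow> \<exists>C\<ge>0. \<forall>x. norm (f x) \<le> C * decay_weight x"
  by (intro decay_weight_bound schwartz_decay)

lemma schwartz_continuous: "schwartz f \<Longrightarrow> continuous_on UNIV f"
  by (intro continuous_at_imp_continuous_on ballI differentiable_imp_continuous_within schwartz_differentiable)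

lemma schwartz_borel: "schwartz f \<Longrightarrow> f \<in> borel_measurable borel"
  by (intro borel_measurable_continuous_onI schwartz_continuous)

lemma schwartz_measurable: "schwartz f \<Longrightarrow> f \<in> borel_measurable lebesgue"
  by (intro measurable_lebesgue_of_borel schwartz_borel)

lemma integrable_of_decay:
  fixes f :: "real ^ 'n::finite \<Rightarrow> complex"
  assumes "f \<in> borel_measurable lebesgue" and "\<And>x. norm (f x) \<le> C * decay_weight x"
  shows "integrable lebesgue f"
  by (rule Bochner_Integration.integrable_bound[OF integrable_mult_right[OF integrable_decay_weight, of C]])
     (use assms in \<open>auto intro: order_trans[OF _ abs_ge_self]\<close>)

lemma schwartz_integrable: "schwartz f \<Longrightarrow> integrable lebesgue f"
  using schwartz_weight_bound[of f] integrable_of_decay[OF schwartz_measurable, of f] by blast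

text \<open>The squared L^2 norm. Extended values remove integrability side conditions and the
  square avoids roots; the price is a factor 2 in the triangle inequality.\<close>

definition energy :: "(real ^ 'n::finite \<Rightarrow> complex) \<Rightarrow> ennreal" where
  "energy f = (\<integral>\<^sup>+ x. ennreal ((norm (f x))\<^sup>2) \<partial>lebesgue)"

lemma energy_finite_of_decay:
  fixes f :: "real ^ 'n::finite \<Rightarrow> complex"
  assumes "\<And>x. norm (f x) \<le> C * decay_weight x"
  shows "energy f < \<infinity>"
proof -
  have "energy f \<le> (\<integral>\<^sup>+ x. ennreal (C\<^sup>2 * decay_weight (x :: real^'n)) \<partial>lebesgue)"
    unfolding energy_def
  proof (intro nn_integral_mono ennreal_leI)
    fix x
    have "(norm (f x))\<^sup>2 \<le> (C * decay_weight x)\<^sup>2"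
      by (intro power_mono assms) simp
    also have "\<dots> \<le> C\<^sup>2 * decay_weight x"
      using mult_left_mono[OF decay_weight_le_1[of x] decay_weight_nonneg[of x]]
      unfolding power_mult_distrib by (intro mult_left_mono) (simp_all add: power2_eq_square)
    finally show "(norm (f x))\<^sup>2 \<le> C\<^sup>2 * decay_weight x" .
  qed
  also have "integrable lebesgue (\<lambda>x::real^'n. C\<^sup>2 * decay_weight x)"
    by (intro integrable_mult_right integrable_decay_weight)
  then have "(\<integral>\<^sup>+ x. ennreal (C\<^sup>2 * decay_weight (x :: real^'n)) \<partial>lebesgue) < \<infinity>"
    unfolding integrable_iff_bounded by (simp add: abs_mult)
  finally show ?thesis .
qed

lemma id_lebesgue_borel[measurable]: "(\<lambda>x. x) \<in> lebesgue \<rightarrow>\<^sub>M borel"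
  by (simp add: measurable_completion)

text \<open>Oscillating and Gaussian kernels are Borel functions of the pair of variables, so
  projections into \<open>borel\<close> make them measurable for the product of the completed
  measures.\<close>

lemma measurable_lebesgue_pair[measurable]:
  "fst \<in> (lebesgue \<Otimes>\<^sub>M M) \<rightarrow>\<^sub>M borel" "snd \<in> (M \<Otimes>\<^sub>M lebesgue) \<rightarrow>\<^sub>M borel"
  using measurable_compose[OF measurable_fst id_lebesgue_borel] measurable_compose[OF measurable_snd id_lebesgue_borel]
  by auto

lemma borel_measurable_fourier:
  assumes [measurable]: "f \<in> borel_measurable lebesgue"
  shows "fourier f \<in> borel_measurable lebesgue"
proof -
  have "(\<lambda>\<xi>. LINT x|lebesgue. cis (- 2 * pi * (x \<bullet> \<xi>)) * f x) \<in> borel_measurable lebesgue"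
    by (rule leb.borel_measurable_lebesgue_integral) measurable
  then show ?thesis by (simp add: fourier_def[abs_def])
qed

lemma integrable_fourier_integrand:
  "integrable lebesgue f \<Longrightarrow> integrable lebesgue (\<lambda>x. cis (a * (x \<bullet> \<xi>)) * f x)"
  by (rule integrable_fourier_kernel) (auto intro: measurable_lebesgue_of_borel)

lemma norm_fourier_le: "norm (fourier f \<xi>) \<le> (LINT x|lebesgue. norm (f x))"
  unfolding fourier_def by (rule order_trans[OF integral_norm_bound]) (simp add: norm_mult)

section \<open>Differentiation and the Fourier transform\<close>

lemma schwartz_along_axis:
  assumes "schwartz f"
  shows "((\<lambda>s. f (x + s *\<^sub>R axis i 1)) has_derivative (\<lambda>h. h *\<^sub>R partial i f (x + s *\<^sub>R axis i 1))) (at s)"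
proof -
  let ?D = "frechet_derivative f (at (x + s *\<^sub>R axis i 1))"
  have D: "(f has_derivative ?D) (at (x + s *\<^sub>R axis i 1))"
    by (rule schwartz_has_derivative[OF assms])
  have "((\<lambda>s. f (x + s *\<^sub>R axis i 1)) has_derivative (\<lambda>h. ?D (h *\<^sub>R axis i 1))) (at s)"
    by (rule has_derivative_compose[where f="\<lambda>s. x + s *\<^sub>R axis i 1", OF _ D]) (auto intro!: derivative_eq_intros)
  then show ?thesis
    using has_derivative_bounded_linear[OF D]
    by (simp add: partial_def linear_cmul bounded_linear.linear)
qed

text \<open>The mean value inequality bounds the quotient by the derivative at an intermediate
  point, and \<open>decay_weight_translate\<close> moves the weight back to \<open>x\<close>. The
  bound does not involve \<open>t\<close>, as dominated convergence requires.\<close>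

lemma schwartz_difference_quotient_bound:
  fixes f :: "real ^ 'n::finite \<Rightarrow> complex"
  assumes f: "schwartz f" and C: "\<And>x. norm (partial i f x) \<le> C * decay_weight x" "0 \<le> C"
    and t: "0 < t" "t \<le> 1"
  shows "norm (inverse t *\<^sub>R (f (x + t *\<^sub>R axis i 1) - f x)) \<le> C * 3 ^ CARD('n) * decay_weight x"
proof -
  have "\<exists>s\<in>{0<..<t}. norm (f (x + t *\<^sub>R axis i 1) - f (x + 0 *\<^sub>R axis i 1))
      \<le> norm ((t - 0) *\<^sub>R partial i f (x + s *\<^sub>R axis i 1))"
    using t(1) schwartz_along_axis[OF f]
    by (intro mvt_general[where f="\<lambda>s. f (x + s *\<^sub>R axis i 1)"] continuous_at_imp_continuous_on)
       (auto intro: has_derivative_continuous)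
  then obtain s where s: "0 < s" "s < t" "norm (f (x + t *\<^sub>R axis i 1) - f x) \<le> t * norm (partial i f (x + s *\<^sub>R axis i 1))"
    using t by auto
  have "norm (inverse t *\<^sub>R (f (x + t *\<^sub>R axis i 1) - f x)) \<le> norm (partial i f (x + s *\<^sub>R axis i 1))"
    unfolding norm_scaleR using s t by (simp add: field_simps)
  also have "\<dots> \<le> C * decay_weight (x + s *\<^sub>R axis i 1)" by (rule C)
  also have "\<dots> \<le> C * (3 ^ CARD('n) * decay_weight x)"
    using s t by (intro mult_left_mono decay_weight_translate C) (simp add: norm_axis_1)
  finally show ?thesis by simp
qed

text \<open>The double inverse matches the quotient \<open>q\<close> of
  \<open>fourier_partial\<close> once its step size is unfolded.\<close>

lemma schwartz_difference_quotient_tendsto: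
  assumes f: "schwartz f"
  shows "(\<lambda>k. inverse (inverse (real (Suc k))) *\<^sub>R (f (x + inverse (real (Suc k)) *\<^sub>R axis i 1) - f x)) \<longlonglongrightarrow> partial i f x"
proof -
  have "((\<lambda>s. f (x + s *\<^sub>R axis i 1)) has_vector_derivative partial i f x) (at 0)"
    using schwartz_along_axis[OF f, of x i 0] by (simp add: has_vector_derivative_def)
  then have *: "((\<lambda>y. norm (f (x + y *\<^sub>R axis i 1) - f (x + 0 *\<^sub>R axis i 1) - (y - 0) *\<^sub>R partial i f x) / norm (y - 0)) \<longlongrightarrow> 0) (at 0)"
    unfolding has_vector_derivative_def has_derivative_iff_norm by (rule conjunct2)
  have "((\<lambda>h. (f (x + h *\<^sub>R axis i 1) - f x) /\<^sub>R h) \<longlongrightarrow> partial i f x) (at 0)"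
  proof (rule LIM_zero_cancel, rule tendsto_norm_zero_cancel)
    have "norm ((f (x + y *\<^sub>R axis i 1) - f x) /\<^sub>R y - partial i f x) =
        norm (f (x + y *\<^sub>R axis i 1) - f (x + 0 *\<^sub>R axis i 1) - (y - 0) *\<^sub>R partial i f x) / norm (y - 0)"
      if "y \<noteq> 0" for y
    proof -
      have "(f (x + y *\<^sub>R axis i 1) - f x) /\<^sub>R y - partial i f x
          = inverse y *\<^sub>R (f (x + y *\<^sub>R axis i 1) - f x - y *\<^sub>R partial i f x)"
        using that by (simp add: scaleR_diff_right)
      then show ?thesis using that by (simp add: divide_inverse)
    qed
    then show "((\<lambda>h. norm ((f (x + h *\<^sub>R axis i 1) - f x) /\<^sub>R h - partial i f x)) \<longlongrightarrow> 0) (at 0)"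
      using * by (subst Lim_cong_within[where g="\<lambda>y. norm (f (x + y *\<^sub>R axis i 1) - f (x + 0 *\<^sub>R axis i 1) - (y - 0) *\<^sub>R partial i f x) / norm (y - 0)"]) auto
  qed
  moreover have "filterlim (\<lambda>k. inverse (real (Suc k))) (at 0) sequentially"
    using LIMSEQ_inverse_real_of_nat by (auto simp: filterlim_at)
  ultimately show ?thesis
    by (rule filterlim_compose)
qed

lemma fourier_translate:
  assumes "f \<in> borel_measurable lebesgue"
  shows "fourier (\<lambda>x. f (x + a)) \<xi> = cis (2 * pi * (a \<bullet> \<xi>)) * fourier f \<xi>"
proof -
  let ?h = "\<lambda>y. cis (2 * pi * (a \<bullet> \<xi>)) * (cis (- 2 * pi * (y \<bullet> \<xi>)) * f y)"
  have [measurable]: "f \<in> borel_measurable lebesgue" by fact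
  have "cis (- 2 * pi * (x \<bullet> \<xi>)) * f (x + a) = ?h (x + a)" for x
  proof -
    have "cis (2 * pi * (a \<bullet> \<xi>)) * cis (- 2 * pi * ((x + a) \<bullet> \<xi>)) = cis (- 2 * pi * (x \<bullet> \<xi>))"
      by (simp add: cis_mult inner_add_left algebra_simps)
    then show ?thesis unfolding mult.assoc[symmetric] by simp
  qed
  then have "fourier (\<lambda>x. f (x + a)) \<xi> = (LINT x|lebesgue. ?h (x + a))"
    unfolding fourier_def by (intro Bochner_Integration.integral_cong refl)
  also have "\<dots> = (LINT x|lebesgue. ?h x)"
    by (rule integral_lebesgue_translation) measurable
  finally show ?thesis by (simp add: fourier_def)
qed

text \<open>Takes the place of integration by parts in n variables. The transform of a difference
  quotient has two limits: by dominated convergence that of the derivative, and by the translation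
  rule the derivative of the character times the transform of \<open>f\<close>.\<close>

lemma fourier_partial:
  fixes f :: "real ^ 'n::finite \<Rightarrow> complex"
  assumes f: "schwartz f"
  shows "fourier (partial i f) \<xi> = (2 * pi * \<xi> $ i) * \<i> * fourier f \<xi>"
proof -
  define t where "t k = inverse (real (Suc k))" for k
  have t: "0 < t k" "t k \<le> 1" for k by (auto simp: t_def inverse_le_1_iff)
  define q where "q k x = inverse (t k) *\<^sub>R (f (x + t k *\<^sub>R axis i 1) - f x)" for k x
  obtain C where C: "0 \<le> C" "\<And>x. norm (partial i f x) \<le> C * decay_weight x"
    using schwartz_weight_bound[OF schwartz_partial[OF f]] by blast
  have fm: "f \<in> borel_measurable lebesgue" by (rule schwartz_measurable[OF f])
  have int: "integrable lebesgue (\<lambda>x. f (x + a))" for a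
    by (intro integrable_lebesgue_translation schwartz_integrable f)
  have int': "integrable lebesgue (q k)" for k
    unfolding q_def[abs_def] using int int[of 0] by auto
  have [measurable]: "q k \<in> borel_measurable lebesgue" for k using int' by auto
  have [measurable]: "partial i f \<in> borel_measurable lebesgue"
    by (intro schwartz_measurable schwartz_partial f)
  have L1: "(\<lambda>k. fourier (q k) \<xi>) \<longlonglongrightarrow> fourier (partial i f) \<xi>"
    unfolding fourier_def
  proof (rule integral_dominated_convergence[where w="\<lambda>x. C * 3 ^ CARD('n) * decay_weight x"])
    show "integrable lebesgue (\<lambda>x::real^'n. C * 3 ^ CARD('n) * decay_weight x)"
      by (intro integrable_mult_right integrable_decay_weight)
    show "AE x in lebesgue. (\<lambda>k. cis (- 2 * pi * (x \<bullet> \<xi>)) * q k x) \<longlonglongrightarrow> cis (- 2 * pi * (x \<bullet> \<xi>)) * partial i f x"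
      unfolding q_def t_def by (intro AE_I2 tendsto_mult_left schwartz_difference_quotient_tendsto f)
    show "AE x in lebesgue. norm (cis (- 2 * pi * (x \<bullet> \<xi>)) * q k x) \<le> C * 3 ^ CARD('n) * decay_weight x" for k
      using schwartz_difference_quotient_bound[OF f C(2,1) t] by (simp add: norm_mult q_def)
  qed measurable
  have L2: "fourier (q k) \<xi> = (cis (2 * pi * (t k * \<xi> $ i)) - 1) / of_real (t k) * fourier f \<xi>" for k
  proof -
    have "fourier (q k) \<xi> = (LINT x|lebesgue. inverse (t k) *\<^sub>R
        (cis (- 2 * pi * (x \<bullet> \<xi>)) * f (x + t k *\<^sub>R axis i 1) - cis (- 2 * pi * (x \<bullet> \<xi>)) * f x))"
      by (simp add: fourier_def q_def algebra_simps)
    also have "\<dots> = inverse (t k) *\<^sub>R (fourier (\<lambda>x. f (x + t k *\<^sub>R axis i 1)) \<xi> - fourier f \<xi>)"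
      using integrable_fourier_integrand[OF int[of "t k *\<^sub>R axis i 1"], of "- 2 * pi" \<xi>]
        integrable_fourier_integrand[OF int[of 0], of "- 2 * pi" \<xi>]
      by (simp add: fourier_def Bochner_Integration.integral_diff del: mult_minus_left)
    also have "\<dots> = (cis (2 * pi * (t k * \<xi> $ i)) - 1) / of_real (t k) * fourier f \<xi>"
    proof -
      have "(t k *\<^sub>R axis i 1) \<bullet> \<xi> = t k * \<xi> $ i" by (simp add: inner_axis')
      then show ?thesis
        unfolding fourier_translate[OF fm]
        by (simp only:) (simp add: scaleR_conv_of_real divide_inverse algebra_simps)
    qed
    finally show ?thesis .
  qed
  \<comment> \<open>This is the complex derivative at 0 of z |-> exp(2 pi i \<xi>_i z), taken along
    the real sequence \<open>t\<close>.\<close>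
  have L3: "(\<lambda>k. (cis (2 * pi * (t k * \<xi> $ i)) - 1) / of_real (t k)) \<longlonglongrightarrow> (2 * pi * \<xi> $ i) * \<i>"
  proof -
    let ?c = "complex_of_real (2 * pi * \<xi> $ i) * \<i>"
    have "((\<lambda>z. exp (?c * z)) has_field_derivative ?c) (at 0)"
      by (auto intro!: derivative_eq_intros)
    then have "((\<lambda>z. (exp (?c * z) - 1) / z) \<longlongrightarrow> ?c) (at 0)"
      by (simp add: has_field_derivative_iff)
    moreover have "filterlim (\<lambda>k. complex_of_real (t k)) (at 0) sequentially"
      using tendsto_of_real[OF LIMSEQ_inverse_real_of_nat, where 'a=complex] t
      by (auto simp: filterlim_at t_def simp del: of_real_inverse intro!: eventuallyI)
    ultimately have "(\<lambda>k. (exp (?c * of_real (t k)) - 1) / of_real (t k)) \<longlonglongrightarrow> ?c"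
      by (rule filterlim_compose)
    then show ?thesis by (simp add: cis_conv_exp mult_ac)
  qed
  show ?thesis
    by (rule LIMSEQ_unique[OF L1[unfolded L2] tendsto_mult_right[OF L3]])
qed

text \<open>Only pure derivatives in a single direction are used: N of them multiply the transform
  by a multiple of the N-th power of one coordinate, and the largest coordinate controls the
  norm.\<close>

lemma fourier_decay:
  fixes f :: "real ^ 'n::finite \<Rightarrow> complex"
  assumes f: "schwartz f"
  shows "\<exists>C\<ge>0. \<forall>\<xi>. norm (fourier f \<xi>) \<le> C * decay_weight \<xi>"
proof (rule decay_weight_bound)
  fix N
  have eq: "fourier (partials (replicate N i) f) \<xi> = ((2 * pi * \<xi> $ i) * \<i>) ^ N * fourier f \<xi>" for i \<xi>
    by (induction N) (simp_all add: fourier_partial[OF schwartz_partials[OF f]])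
  define C where "C i = (LINT x|lebesgue. norm (partials (replicate N i) f x))" for i
  have C0: "0 \<le> C i" for i by (simp add: C_def)
  have C: "\<bar>\<xi> $ i\<bar> ^ N * norm (fourier f \<xi>) \<le> C i" for i \<xi>
  proof -
    have "\<bar>\<xi> $ i\<bar> ^ N \<le> \<bar>2 * pi * \<xi> $ i\<bar> ^ N"
      using pi_ge_two mult_right_mono[of 1 "2 * pi" "\<bar>\<xi> $ i\<bar>"] by (intro power_mono) (auto simp: abs_mult)
    then have "\<bar>\<xi> $ i\<bar> ^ N * norm (fourier f \<xi>) \<le> \<bar>2 * pi * \<xi> $ i\<bar> ^ N * norm (fourier f \<xi>)"
      by (rule mult_right_mono) simp
    also have "\<dots> = norm (fourier (partials (replicate N i) f) \<xi>)"
      unfolding eq norm_mult norm_power norm_of_real by simp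
    also have "\<dots> \<le> C i" unfolding C_def by (rule norm_fourier_le)
    finally show ?thesis .
  qed
  have "norm \<xi> ^ N * norm (fourier f \<xi>) \<le> of_nat CARD('n) ^ N * (\<Sum>i\<in>UNIV. C i)" for \<xi>
  proof -
    \<comment> \<open>The choice of \<open>j\<close> depends on the frequency, so the final bound
      sums the constants over all coordinates.\<close>
    obtain j where j: "\<And>i. \<bar>\<xi> $ i\<bar> \<le> \<bar>\<xi> $ j\<bar>"
    proof -
      have "Max (range (\<lambda>i. \<bar>\<xi> $ i\<bar>)) \<in> range (\<lambda>i. \<bar>\<xi> $ i\<bar>)" by (rule Max_in) auto
      then obtain j where "Max (range (\<lambda>i. \<bar>\<xi> $ i\<bar>)) = \<bar>\<xi> $ j\<bar>" by blast
      moreover have "\<bar>\<xi> $ i\<bar> \<le> Max (range (\<lambda>i. \<bar>\<xi> $ i\<bar>))" for i by (rule Max_ge) auto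
      ultimately show thesis using that[of j] by metis
    qed
    have "norm \<xi> \<le> (\<Sum>i\<in>UNIV. \<bar>\<xi> $ i\<bar>)" by (rule norm_le_l1_cart)
    also have "\<dots> \<le> of_nat CARD('n) * \<bar>\<xi> $ j\<bar>"
      by (rule sum_bounded_above) (rule j)
    finally have "norm \<xi> ^ N \<le> of_nat CARD('n) ^ N * \<bar>\<xi> $ j\<bar> ^ N"
      unfolding power_mult_distrib[symmetric] by (rule power_mono) simp
    then have "norm \<xi> ^ N * norm (fourier f \<xi>) \<le> of_nat CARD('n) ^ N * (\<bar>\<xi> $ j\<bar> ^ N * norm (fourier f \<xi>))"
      unfolding mult.assoc[symmetric] by (rule mult_right_mono) simp
    also have "\<dots> \<le> of_nat CARD('n) ^ N * C j"
      by (rule mult_left_mono[OF C]) simp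
    also have "\<dots> \<le> of_nat CARD('n) ^ N * (\<Sum>i\<in>UNIV. C i)"
      using member_le_sum[of j UNIV C] C0 by (intro mult_left_mono) auto
    finally show ?thesis .
  qed
  then show "\<exists>C. \<forall>\<xi>. norm \<xi> ^ N * norm (fourier f \<xi>) \<le> C" by blast
qed

section \<open>Gaussian summation: inversion and the Plancherel inequality\<close>

text \<open>Fubini: the kernel is unimodular and symmetric in its two variables, so integrability of
  a(x) b(\<xi>) is enough.\<close>

lemma fourier_multiplication_formula:
  fixes a b :: "real ^ 'n::finite \<Rightarrow> complex"
  assumes a: "integrable lebesgue a" and b: "integrable lebesgue b"
  shows "(LINT \<xi>|lebesgue. fourier a \<xi> * b \<xi>) = (LINT x|lebesgue. a x * fourier b x)"
proof -
  let ?h = "\<lambda>x \<xi>. cis (- 2 * pi * (x \<bullet> \<xi>)) * (a x * b \<xi>)"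
  have [measurable]: "a \<in> borel_measurable lebesgue" "b \<in> borel_measurable lebesgue"
    using a b by auto
  have "integrable (lebesgue \<Otimes>\<^sub>M lebesgue) (case_prod ?h)"
  proof (rule leb2.Fubini_integrable)
    show "case_prod ?h \<in> borel_measurable (lebesgue \<Otimes>\<^sub>M lebesgue)" by measurable
    show "integrable lebesgue (\<lambda>x. LINT \<xi>|lebesgue. norm (case (x, \<xi>) of (x, \<xi>) \<Rightarrow> ?h x \<xi>))"
      using a by (simp add: norm_mult)
    show "AE x in lebesgue. integrable lebesgue (\<lambda>\<xi>. case (x, \<xi>) of (x, \<xi>) \<Rightarrow> ?h x \<xi>)"
      using integrable_fourier_kernel[of "\<lambda>\<xi>. a _ * b \<xi>" "\<lambda>\<xi>. - 2 * pi * (_ \<bullet> \<xi>)"] b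
      by (auto intro!: integrable_fourier_kernel simp del: mult_minus_left)
  qed
  then have "(LINT \<xi>|lebesgue. LINT x|lebesgue. ?h x \<xi>) = (LINT x|lebesgue. LINT \<xi>|lebesgue. ?h x \<xi>)"
    by (rule leb2.Fubini_integral)
  moreover have "(LINT x|lebesgue. ?h x \<xi>) = fourier a \<xi> * b \<xi>" for \<xi>
    unfolding fourier_def mult.assoc[symmetric] by (rule integral_mult_left_zero)
  moreover have "(LINT \<xi>|lebesgue. ?h x \<xi>) = a x * fourier b x" for x
  proof -
    have "?h x \<xi> = a x * (cis (- 2 * pi * (\<xi> \<bullet> x)) * b \<xi>)" for \<xi>
      by (simp add: inner_commute mult_ac)
    then show ?thesis unfolding fourier_def by (simp only: integral_mult_right_zero)
  qed
  ultimately show ?thesis by simp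
qed

lemma inv_fourier_eq: "inv_fourier g x = fourier g (- x)"
  unfolding inv_fourier_def fourier_def by (simp add: inner_commute)

lemma borel_measurable_reflect:
  "f \<in> borel_measurable lebesgue \<Longrightarrow> (\<lambda>x::'a::euclidean_space. f (- x)) \<in> borel_measurable lebesgue"
  using borel_measurable_lebesgue_affine[of "-1" f 0] by simp

lemma borel_measurable_inv_fourier:
  "f \<in> borel_measurable lebesgue \<Longrightarrow> inv_fourier f \<in> borel_measurable lebesgue"
  unfolding inv_fourier_eq[abs_def] by (intro borel_measurable_reflect borel_measurable_fourier)

text \<open>The multiplication formula applied to a modulated Gaussian, whose transform is the
  translated kernel. The Gaussian makes the frequency integral converge although
  \<open>fourier w\<close> itself may fail to be integrable.\<close>

lemma gauss_summation:
  fixes w :: "real ^ 'n::finite \<Rightarrow> complex"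
  assumes w: "integrable lebesgue w" and s: "0 < s"
  shows "inv_fourier (\<lambda>\<xi>. of_real (gauss s \<xi>) * fourier w \<xi>) x = (LINT y|lebesgue. w y * of_real (gauss_kernel s (y - x)))"
proof -
  let ?b = "\<lambda>\<xi>. cis (2 * pi * (x \<bullet> \<xi>)) * of_real (gauss s \<xi>)"
  have "integrable lebesgue ?b"
    by (intro integrable_fourier_kernel integrable_of_real integrable_gauss s measurable_lebesgue_of_borel) measurable
  then have "(LINT \<xi>|lebesgue. fourier w \<xi> * ?b \<xi>) = (LINT y|lebesgue. w y * fourier ?b y)"
    by (rule fourier_multiplication_formula[OF w])
  moreover have "fourier ?b y = of_real (gauss_kernel s (y - x))" for y
  proof -
    have "cis (- 2 * pi * (\<xi> \<bullet> y)) * ?b \<xi> = cis (- 2 * pi * (\<xi> \<bullet> (y - x))) * of_real (gauss s \<xi>)" for \<xi>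
      by (simp add: cis_mult mult.assoc[symmetric] inner_diff_right)
        (simp add: inner_commute algebra_simps)
    then have "fourier ?b y = fourier (\<lambda>\<xi>. of_real (gauss s \<xi>)) (y - x)"
      unfolding fourier_def by (intro Bochner_Integration.integral_cong refl)
    then show ?thesis by (simp add: fourier_gauss[OF s])
  qed
  ultimately show ?thesis
    unfolding inv_fourier_def by (simp add: mult_ac)
qed

lemma integrable_fourier_schwartz:
  assumes "schwartz f" shows "integrable lebesgue (fourier f)"
  using fourier_decay[OF assms] integrable_of_decay[OF borel_measurable_fourier[OF schwartz_measurable[OF assms]]] by blast

text \<open>Both sides of \<open>gauss_summation\<close> are followed as the width tends to 0. On
  the frequency side the integrable transform dominates; on the space side, after rescaling,
  boundedness and continuity of \<open>f\<close> and the unit mass of the kernel yield the point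
  value.\<close>

lemma inv_fourier_fourier:
  fixes f :: "real ^ 'n::finite \<Rightarrow> complex"
  assumes f: "schwartz f"
  shows "inv_fourier (fourier f) x = f x"
proof -
  define s where "s k = inverse (real (Suc k))" for k
  have s: "0 < s k" for k by (auto simp: s_def)
  have s_lim: "s \<longlonglongrightarrow> 0" unfolding s_def using LIMSEQ_inverse_real_of_nat .
  obtain M where M: "\<And>x. norm (f x) \<le> M" using schwartz_decay[OF f, of 0] by auto
  have fm[measurable]: "f \<in> borel_measurable borel" by (rule schwartz_borel[OF f])
  have fF: "fourier f \<in> borel_measurable lebesgue"
    by (intro borel_measurable_fourier schwartz_measurable f)
  have gm: "gauss s \<in> borel_measurable lebesgue" for s :: real
    by (intro measurable_lebesgue_of_borel) simp
  note [measurable] = fF gm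
  have L1: "(\<lambda>k. inv_fourier (\<lambda>\<xi>. of_real (gauss (s k) \<xi>) * fourier f \<xi>) x) \<longlonglongrightarrow> inv_fourier (fourier f) x"
    unfolding inv_fourier_def
  proof (rule integral_dominated_convergence[where w="\<lambda>\<xi>. norm (fourier f \<xi>)"])
    show "integrable lebesgue (\<lambda>\<xi>. norm (fourier f \<xi>))"
      using integrable_fourier_schwartz[OF f] by simp
    have "(\<lambda>k. cis (2 * pi * (x \<bullet> \<xi>)) * (of_real (gauss (s k) \<xi>) * fourier f \<xi>)) \<longlonglongrightarrow>
        cis (2 * pi * (x \<bullet> \<xi>)) * (of_real 1 * fourier f \<xi>)" for \<xi>
      by (intro tendsto_intros tendsto_gauss s_lim)
    then show "AE \<xi> in lebesgue. (\<lambda>k. cis (2 * pi * (x \<bullet> \<xi>)) * (of_real (gauss (s k) \<xi>) * fourier f \<xi>)) \<longlonglongrightarrow>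
        cis (2 * pi * (x \<bullet> \<xi>)) * fourier f \<xi>" by simp
    show "AE \<xi> in lebesgue. norm (cis (2 * pi * (x \<bullet> \<xi>)) * (of_real (gauss (s k) \<xi>) * fourier f \<xi>)) \<le> norm (fourier f \<xi>)" for k
      using mult_left_le_one_le[OF norm_ge_zero gauss_nonneg gauss_le_1] by (intro AE_I2) (simp add: norm_mult)
  qed measurable
  have L2: "inv_fourier (\<lambda>\<xi>. of_real (gauss (s k) \<xi>) * fourier f \<xi>) x
      = (LINT z|lebesgue. f (x + s k *\<^sub>R z) * of_real (gauss_kernel 1 z))" for k
  proof -
    have "(LINT y|lebesgue. f y * of_real (gauss_kernel (s k) (y - x))) =
        \<bar>s k\<bar> ^ DIM(real^'n) *\<^sub>R (LINT z|lebesgue. f (x + s k *\<^sub>R z) * of_real (gauss_kernel (s k) (x + s k *\<^sub>R z - x)))"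
      using s[of k] by (intro integral_lebesgue_affine measurable_lebesgue_of_borel) auto
    also have "\<dots> = (LINT z|lebesgue. f (x + s k *\<^sub>R z) * of_real (gauss_kernel (s k) (s k *\<^sub>R z) * s k ^ CARD('n)))"
      using s[of k] by (subst integral_scaleR_right[symmetric]) (simp add: scaleR_conv_of_real mult_ac)
    finally show ?thesis
      unfolding gauss_summation[OF schwartz_integrable[OF f] s] gauss_kernel_scale[OF s] .
  qed
  have L3: "(\<lambda>k. LINT z|lebesgue. f (x + s k *\<^sub>R z) * of_real (gauss_kernel 1 z)) \<longlonglongrightarrow>
      (LINT z|lebesgue. f x * of_real (gauss_kernel 1 (z :: real^'n)))"
  proof (rule integral_dominated_convergence[where w="\<lambda>z. M * gauss_kernel 1 z"])
    show "integrable lebesgue (\<lambda>z::real^'n. M * gauss_kernel 1 z)"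
      by (intro integrable_mult_right integrable_gauss_kernel) simp
    have "(\<lambda>k. f (x + s k *\<^sub>R z)) \<longlonglongrightarrow> f (x + 0 *\<^sub>R z)" for z
      using schwartz_continuous[OF f] by (intro isCont_tendsto_compose[of _ f] tendsto_intros s_lim)
        (simp add: continuous_on_eq_continuous_at)
    then show "AE z in lebesgue. (\<lambda>k. f (x + s k *\<^sub>R z) * of_real (gauss_kernel 1 z)) \<longlonglongrightarrow> f x * of_real (gauss_kernel 1 z)"
      by (auto intro!: tendsto_mult_right)
    show "AE z in lebesgue. norm (f (x + s k *\<^sub>R z) * of_real (gauss_kernel 1 z)) \<le> M * gauss_kernel 1 z" for k
      using M by (simp add: norm_mult mult_right_mono)
  qed (auto intro!: measurable_lebesgue_of_borel)
  have L4: "(LINT z|lebesgue. f x * of_real (gauss_kernel 1 (z :: real^'n))) = f x"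
    using integral_gauss_kernel[of 1, where 'n='n] by (subst integral_mult_right_zero) simp
  show ?thesis
    by (rule LIMSEQ_unique[OF L1[unfolded L2] L3, unfolded L4])
qed

text \<open>The inverse transform is the transform reflected, so reflecting the variable of
  integration exchanges the two compositions.\<close>

lemma fourier_inv_fourier:
  fixes f :: "real ^ 'n::finite \<Rightarrow> complex"
  assumes f: "schwartz f"
  shows "fourier (inv_fourier f) x = f x"
proof -
  have m: "(\<lambda>\<xi>. cis (2 * pi * (x \<bullet> \<xi>)) * fourier f \<xi>) \<in> borel_measurable lebesgue"
  proof -
    have [measurable]: "fourier f \<in> borel_measurable lebesgue"
      by (intro borel_measurable_fourier schwartz_measurable f)
    show ?thesis by measurable
  qed
  have "fourier (inv_fourier f) x = (LINT \<xi>|lebesgue. cis (2 * pi * (x \<bullet> (- \<xi>))) * fourier f (- \<xi>))"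
    unfolding fourier_def[of "inv_fourier f"] inv_fourier_eq by (simp add: inner_commute)
  also have "\<dots> = inv_fourier (fourier f) x"
    unfolding inv_fourier_def by (rule integral_lebesgue_reflect[OF m])
  finally show ?thesis using inv_fourier_fourier[OF f] by simp
qed

section \<open>The L^2 bound for the Fourier transform\<close>

lemma ennreal_norm_integral_le:
  fixes f :: "'a \<Rightarrow> 'b::{banach, second_countable_topology}"
  shows "ennreal (norm (LINT x|M. f x)) \<le> (\<integral>\<^sup>+ x. ennreal (norm (f x)) \<partial>M)"
  \<comment> \<open>Without integrability the left side is 0, the default value of the
    integral.\<close>
  by (cases "integrable M f") (auto simp: integral_norm_bound_ennreal not_integrable_integral_eq)

text \<open>Schur test: |w(x)| |w(y)| is at most half the sum of the squares, and the unit mass of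
  the kernel in either variable turns each half into half the energy.\<close>

lemma gauss_kernel_schur:
  fixes w :: "real ^ 'n::finite \<Rightarrow> complex"
  assumes [measurable]: "w \<in> borel_measurable lebesgue" and s: "0 < s"
  shows "(\<integral>\<^sup>+ x. \<integral>\<^sup>+ y. ennreal (norm (w x) * (norm (w y) * gauss_kernel s (y - x))) \<partial>lebesgue \<partial>lebesgue) \<le> energy w"
proof -
  let ?K = "\<lambda>x y. gauss_kernel s (y - x) :: real"
  let ?e = "\<lambda>x. ennreal ((norm (w x))\<^sup>2 / 2)"
  have [measurable]: "(\<lambda>z. gauss_kernel s (snd z - fst z)) \<in> borel_measurable (lebesgue \<Otimes>\<^sub>M lebesgue)"
    by (rule measurable_compose[OF _ borel_measurable_gauss_kernel]) measurable
  have [measurable]: "(\<lambda>y. gauss_kernel s (y - x)) \<in> borel_measurable lebesgue" for x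
    by (intro measurable_lebesgue_of_borel) measurable
  have half: "(\<integral>\<^sup>+ x. ?e x \<partial>lebesgue) = ennreal (1/2) * energy w"
  proof -
    have "?e x = ennreal (1/2) * ennreal ((norm (w x))\<^sup>2)" for x
      by (subst ennreal_mult[symmetric]) auto
    then show ?thesis unfolding energy_def by (simp add: nn_integral_cmult)
  qed
  have "(\<integral>\<^sup>+ x. \<integral>\<^sup>+ y. ennreal (norm (w x) * (norm (w y) * ?K x y)) \<partial>lebesgue \<partial>lebesgue)
      \<le> (\<integral>\<^sup>+ x. \<integral>\<^sup>+ y. ?e x * ennreal (?K x y) + ?e y * ennreal (?K x y) \<partial>lebesgue \<partial>lebesgue)"
  proof (intro nn_integral_mono)
    fix x y
    have "norm (w x) * norm (w y) \<le> (norm (w x))\<^sup>2 / 2 + (norm (w y))\<^sup>2 / 2"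
      using zero_le_power2[of "norm (w x) - norm (w y)"] unfolding power2_diff by simp
    then have "norm (w x) * (norm (w y) * ?K x y) \<le> ((norm (w x))\<^sup>2 / 2 + (norm (w y))\<^sup>2 / 2) * ?K x y"
      unfolding mult.assoc[symmetric] by (rule mult_right_mono) simp
    then show "ennreal (norm (w x) * (norm (w y) * ?K x y)) \<le> ?e x * ennreal (?K x y) + ?e y * ennreal (?K x y)"
      by (simp add: ennreal_mult[symmetric] ennreal_plus[symmetric] distrib_right ennreal_leI del: ennreal_plus)
  qed
  also have "\<dots> = (\<integral>\<^sup>+ x. ?e x + (\<integral>\<^sup>+ y. ?e y * ennreal (?K x y) \<partial>lebesgue) \<partial>lebesgue)"
    by (simp add: nn_integral_add nn_integral_cmult nn_integral_gauss_kernel[OF s])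
  also have "\<dots> = (\<integral>\<^sup>+ x. ?e x \<partial>lebesgue) + (\<integral>\<^sup>+ x. \<integral>\<^sup>+ y. ?e y * ennreal (?K x y) \<partial>lebesgue \<partial>lebesgue)"
    by (intro nn_integral_add leb.borel_measurable_nn_integral) measurable
  \<comment> \<open>Here the factor depends on the inner variable, so the order of integration is
    exchanged before the mass of the kernel can be used.\<close>
  also have "(\<integral>\<^sup>+ x. \<integral>\<^sup>+ y. ?e y * ennreal (?K x y) \<partial>lebesgue \<partial>lebesgue)
      = (\<integral>\<^sup>+ y. \<integral>\<^sup>+ x. ?e y * ennreal (?K x y) \<partial>lebesgue \<partial>lebesgue)"
    by (rule leb2.Fubini'[symmetric]) measurable
  also have "\<dots> = (\<integral>\<^sup>+ y. ?e y \<partial>lebesgue)"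
  proof (intro nn_integral_cong)
    fix y :: "real^'n"
    have [measurable]: "(\<lambda>x. gauss_kernel s (y - x)) \<in> borel_measurable lebesgue"
      by (intro measurable_lebesgue_of_borel) measurable
    show "(\<integral>\<^sup>+ x. ?e y * ennreal (?K x y) \<partial>lebesgue) = ?e y"
      by (simp add: nn_integral_cmult nn_integral_gauss_kernel[OF s])
  qed
  also have "(\<integral>\<^sup>+ x. ?e x \<partial>lebesgue) + (\<integral>\<^sup>+ x. ?e x \<partial>lebesgue) = energy w"
  proof -
    have "ennreal (1/2) + ennreal (1/2) = 1" by (subst ennreal_plus[symmetric]) auto
    then show ?thesis unfolding half distrib_right[symmetric] by (simp only: mult_1_left)
  qed
  finally show ?thesis .
qed

lemma borel_measurable_cnj[measurable]: "cnj \<in> borel_measurable borel"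
  by (intro borel_measurable_continuous_onI continuous_intros)

text \<open>Duality: the weighted square of the transform is a pairing that the multiplication
  formula moves to the space side, where it becomes \<open>w\<close> against the conjugate of its
  own Gaussian average.\<close>

lemma energy_fourier_gauss_le:
  fixes w :: "real ^ 'n::finite \<Rightarrow> complex"
  assumes w: "integrable lebesgue w" and s: "0 < s"
  shows "(\<integral>\<^sup>+ \<xi>. ennreal ((norm (fourier w \<xi>))\<^sup>2 * gauss s \<xi>) \<partial>lebesgue) \<le> energy w"
proof -
  have [measurable]: "w \<in> borel_measurable lebesgue" using w by auto
  have [measurable]: "fourier w \<in> borel_measurable lebesgue" by (rule borel_measurable_fourier) simp
  have [measurable]: "gauss s \<in> borel_measurable lebesgue"
    by (intro measurable_lebesgue_of_borel) simp
  define B where "B = (LINT x|lebesgue. norm (w x))"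
  have B: "norm (fourier w \<xi>) \<le> B" for \<xi> unfolding B_def by (rule norm_fourier_le)
  \<comment> \<open>Chosen so that \<open>fourier w \<xi> * b \<xi>\<close> is the weighted square;
    it is integrable because the transform is bounded by \<open>B\<close> and the Gaussian is
    integrable.\<close>
  define b where "b \<xi> = of_real (gauss s \<xi>) * cnj (fourier w \<xi>)" for \<xi>
  have [measurable]: "b \<in> borel_measurable lebesgue"
    unfolding b_def[abs_def] by measurable
  have bi: "integrable lebesgue b"
  proof (rule Bochner_Integration.integrable_bound[OF integrable_mult_right[OF integrable_gauss[OF s], of B]])
    show "AE \<xi> in lebesgue. norm (b \<xi>) \<le> norm (B * gauss s \<xi>)"
      using order_trans[OF B abs_ge_self]
      by (intro AE_I2) (simp add: b_def norm_mult abs_mult mult.commute)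
  qed measurable
  have i: "integrable lebesgue (\<lambda>\<xi>. (norm (fourier w \<xi>))\<^sup>2 * gauss s \<xi>)"
  proof (rule Bochner_Integration.integrable_bound[OF integrable_mult_right[OF integrable_gauss[OF s], of "B\<^sup>2"]])
    show "AE \<xi> in lebesgue. norm ((norm (fourier w \<xi>))\<^sup>2 * gauss s \<xi>) \<le> norm (B\<^sup>2 * gauss s \<xi>)"
      using B by (intro AE_I2) (simp add: mult_right_mono power_mono)
  qed measurable
  have bF: "fourier b x = cnj (LINT y|lebesgue. w y * of_real (gauss_kernel s (y - x)))" for x
  proof -
    have "fourier b x = cnj (inv_fourier (\<lambda>\<xi>. of_real (gauss s \<xi>) * fourier w \<xi>) x)"
      unfolding fourier_def[of b] inv_fourier_def Bochner_Integration.integral_cnj[symmetric]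
      by (rule Bochner_Integration.integral_cong[OF refl]) (simp add: b_def cis_cnj inner_commute)
    then show ?thesis by (simp only: gauss_summation[OF w s])
  qed
  have "(\<integral>\<^sup>+ \<xi>. ennreal ((norm (fourier w \<xi>))\<^sup>2 * gauss s \<xi>) \<partial>lebesgue)
      = ennreal (LINT \<xi>|lebesgue. (norm (fourier w \<xi>))\<^sup>2 * gauss s \<xi>)"
    by (rule nn_integral_eq_integral[OF i]) simp
  also have "(LINT \<xi>|lebesgue. (norm (fourier w \<xi>))\<^sup>2 * gauss s \<xi>)
      = norm (LINT \<xi>|lebesgue. complex_of_real ((norm (fourier w \<xi>))\<^sup>2 * gauss s \<xi>))"
    unfolding integral_complex_of_real norm_of_real by (simp add: integral_nonneg_AE)
  also have "(LINT \<xi>|lebesgue. complex_of_real ((norm (fourier w \<xi>))\<^sup>2 * gauss s \<xi>))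
      = (LINT \<xi>|lebesgue. fourier w \<xi> * b \<xi>)"
    by (rule Bochner_Integration.integral_cong[OF refl])
       (simp add: b_def complex_norm_square[symmetric] mult_ac del: of_real_power)
  also have "\<dots> = (LINT x|lebesgue. w x * fourier b x)"
    by (rule fourier_multiplication_formula[OF w bi])
  also have "ennreal (norm (LINT x|lebesgue. w x * fourier b x)) \<le> (\<integral>\<^sup>+ x. ennreal (norm (w x * fourier b x)) \<partial>lebesgue)"
    by (rule ennreal_norm_integral_le)
  also have "\<dots> \<le> (\<integral>\<^sup>+ x. \<integral>\<^sup>+ y. ennreal (norm (w x) * (norm (w y) * gauss_kernel s (y - x))) \<partial>lebesgue \<partial>lebesgue)"
  proof (intro nn_integral_mono)
    fix x :: "real^'n"
    have [measurable]: "(\<lambda>y. gauss_kernel s (y - x)) \<in> borel_measurable lebesgue"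
      by (intro measurable_lebesgue_of_borel) measurable
    have "ennreal (norm (w x * fourier b x)) = ennreal (norm (w x)) * ennreal (norm (LINT y|lebesgue. w y * of_real (gauss_kernel s (y - x))))"
      by (simp add: bF norm_mult ennreal_mult)
    also have "\<dots> \<le> ennreal (norm (w x)) * (\<integral>\<^sup>+ y. ennreal (norm (w y * complex_of_real (gauss_kernel s (y - x)))) \<partial>lebesgue)"
      by (intro mult_left_mono ennreal_norm_integral_le) simp
    also have "\<dots> = (\<integral>\<^sup>+ y. ennreal (norm (w x)) * ennreal (norm (w y) * gauss_kernel s (y - x)) \<partial>lebesgue)"
      by (subst nn_integral_cmult[symmetric]) (auto simp: norm_mult)
    also have "\<dots> = (\<integral>\<^sup>+ y. ennreal (norm (w x) * (norm (w y) * gauss_kernel s (y - x))) \<partial>lebesgue)"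
      by (simp add: ennreal_mult)
    finally show "ennreal (norm (w x * fourier b x)) \<le> \<dots>" .
  qed
  also have "\<dots> \<le> energy w" by (rule gauss_kernel_schur[OF _ s]) simp
  finally show ?thesis .
qed

text \<open>Fatou's lemma along Gaussians tending to 1. Fatou yields just this half of Plancherel;
  the reverse estimate, up to a constant, is recovered later from inversion and density.\<close>

lemma energy_fourier_le:
  fixes w :: "real ^ 'n::finite \<Rightarrow> complex"
  assumes w: "integrable lebesgue w"
  shows "energy (fourier w) \<le> energy w"
proof -
  define s where "s k = inverse (real (Suc k))" for k
  have s: "0 < s k" for k by (auto simp: s_def)
  have s_lim: "s \<longlonglongrightarrow> 0" unfolding s_def using LIMSEQ_inverse_real_of_nat .
  have [measurable]: "fourier w \<in> borel_measurable lebesgue"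
    using w by (intro borel_measurable_fourier) auto
  have [measurable]: "gauss s \<in> borel_measurable lebesgue" for s :: real
    by (intro measurable_lebesgue_of_borel) simp
  have "(\<lambda>k. ennreal ((norm (fourier w \<xi>))\<^sup>2 * gauss (s k) \<xi>)) \<longlonglongrightarrow> ennreal ((norm (fourier w \<xi>))\<^sup>2 * 1)" for \<xi>
    by (intro tendsto_intros tendsto_ennrealI tendsto_gauss s_lim)
  then have "liminf (\<lambda>k. ennreal ((norm (fourier w \<xi>))\<^sup>2 * gauss (s k) \<xi>)) = ennreal ((norm (fourier w \<xi>))\<^sup>2)" for \<xi>
    using lim_imp_Liminf[OF sequentially_bot] by (metis mult.right_neutral)
  then have "energy (fourier w) = (\<integral>\<^sup>+ \<xi>. liminf (\<lambda>k. ennreal ((norm (fourier w \<xi>))\<^sup>2 * gauss (s k) \<xi>)) \<partial>lebesgue)"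
    unfolding energy_def by simp
  also have "\<dots> \<le> liminf (\<lambda>k. \<integral>\<^sup>+ \<xi>. ennreal ((norm (fourier w \<xi>))\<^sup>2 * gauss (s k) \<xi>) \<partial>lebesgue)"
    by (rule nn_integral_liminf) measurable
  also have "\<dots> \<le> liminf (\<lambda>k::nat. energy w)"
    by (intro Liminf_mono always_eventually allI energy_fourier_gauss_le w s)
  finally show ?thesis by (simp add: Liminf_const)
qed

lemma energy_reflect:
  assumes [measurable]: "f \<in> borel_measurable lebesgue"
  shows "energy (\<lambda>x. f (- x)) = energy f"
  unfolding energy_def
  using nn_integral_lebesgue_affine[of "-1" "\<lambda>x. ennreal ((norm (f x))\<^sup>2)" 0] by simp

lemma energy_inv_fourier_le:
  assumes "integrable lebesgue w"
  shows "energy (inv_fourier w) \<le> energy w"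
proof -
  have "energy (inv_fourier w) = energy (fourier w)"
    unfolding inv_fourier_eq[abs_def] using assms by (intro energy_reflect borel_measurable_fourier) auto
  then show ?thesis using energy_fourier_le[OF assms] by simp
qed

lemma energy_add_le:
  assumes [measurable]: "f \<in> borel_measurable lebesgue" "g \<in> borel_measurable lebesgue"
  shows "energy (\<lambda>x. f x + g x) \<le> 2 * energy f + 2 * energy g"
proof -
  have "energy (\<lambda>x. f x + g x) \<le> (\<integral>\<^sup>+ x. 2 * ennreal ((norm (f x))\<^sup>2) + 2 * ennreal ((norm (g x))\<^sup>2) \<partial>lebesgue)"
    unfolding energy_def
  proof (intro nn_integral_mono)
    fix x
    have "(norm (f x + g x))\<^sup>2 \<le> (norm (f x) + norm (g x))\<^sup>2"
      by (intro power_mono norm_triangle_ineq) simp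
    also have "\<dots> \<le> 2 * (norm (f x))\<^sup>2 + 2 * (norm (g x))\<^sup>2"
      using zero_le_power2[of "norm (f x) - norm (g x)"] unfolding power2_diff power2_sum by simp
    finally have "ennreal ((norm (f x + g x))\<^sup>2) \<le> ennreal (2 * (norm (f x))\<^sup>2 + 2 * (norm (g x))\<^sup>2)"
      by (rule ennreal_leI)
    then show "ennreal ((norm (f x + g x))\<^sup>2) \<le> 2 * ennreal ((norm (f x))\<^sup>2) + 2 * ennreal ((norm (g x))\<^sup>2)"
      by (simp add: ennreal_plus ennreal_mult)
  qed
  also have "\<dots> = 2 * energy f + 2 * energy g"
    unfolding energy_def by (simp add: nn_integral_add nn_integral_cmult)
  finally show ?thesis .
qed

section \<open>Density of Schwartz functions in L2\<close>

definition schwartz_limit :: "(real ^ 'n::finite \<Rightarrow> complex) \<Rightarrow> bool" where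
  "schwartz_limit f \<longleftrightarrow>
     (\<exists>\<phi>::nat \<Rightarrow> real ^ 'n \<Rightarrow> complex. (\<forall>k. schwartz (\<phi> k)) \<and> (\<lambda>k. energy (\<lambda>x. \<phi> k x - f x)) \<longlonglongrightarrow> 0)"

lemma tendsto_0_sandwich_ennreal:
  fixes a b :: "nat \<Rightarrow> ennreal"
  assumes "b \<longlonglongrightarrow> 0" "\<And>k. a k \<le> b k"
  shows "a \<longlonglongrightarrow> 0"
  using assms by (intro tendsto_sandwich[of "\<lambda>_. 0" a _ b]) auto

lemma tendsto_0_add_ennreal:
  fixes a b :: "nat \<Rightarrow> ennreal"
  assumes "a \<longlonglongrightarrow> 0" "b \<longlonglongrightarrow> 0" "c \<noteq> \<infinity>" "d \<noteq> \<infinity>"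
  shows "(\<lambda>k. c * a k + d * b k) \<longlonglongrightarrow> 0"
proof -
  have "(\<lambda>k. c * a k + d * b k) \<longlonglongrightarrow> c * 0 + d * 0"
    using assms by (intro tendsto_add ennreal_tendsto_cmult) (auto simp: less_top)
  then show ?thesis by simp
qed

lemma energy_cmult: "energy (\<lambda>x. c * f x) = ennreal ((norm c)\<^sup>2) * energy f"
  if [measurable]: "f \<in> borel_measurable lebesgue"
  unfolding energy_def by (simp add: norm_mult power_mult_distrib ennreal_mult nn_integral_cmult)

lemma energy_minus_commute: "energy (\<lambda>x. f x - g x) = energy (\<lambda>x. g x - f x)"
  unfolding energy_def by (simp add: norm_minus_commute)

lemma energy_cong_AE: "AE x in lebesgue. f x = g x \<Longrightarrow> energy f = energy g"
  unfolding energy_def by (rule nn_integral_cong_AE) auto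

lemma energy_triangle:
  assumes [measurable]: "f \<in> borel_measurable lebesgue" "g \<in> borel_measurable lebesgue" "h \<in> borel_measurable lebesgue"
  shows "energy (\<lambda>x. f x - h x) \<le> 2 * energy (\<lambda>x. f x - g x) + 2 * energy (\<lambda>x. g x - h x)"
  using energy_add_le[of "\<lambda>x. f x - g x" "\<lambda>x. g x - h x"] by simp

lemma schwartz_limit_schwartz: "schwartz f \<Longrightarrow> schwartz_limit f"
  unfolding schwartz_limit_def by (intro exI[of _ "\<lambda>_. f"]) (simp add: energy_def)

lemma schwartz_limit_cong_AE:
  assumes "AE x in lebesgue. f x = g x" "schwartz_limit f"
  shows "schwartz_limit g"
proof -
  have "energy (\<lambda>x. \<phi> x - f x) = energy (\<lambda>x. \<phi> x - g x)" for \<phi>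
    using assms(1) by (intro energy_cong_AE) auto
  then show ?thesis using assms(2) unfolding schwartz_limit_def by simp
qed

lemma schwartz_limit_add:
  assumes [measurable]: "f \<in> borel_measurable lebesgue" "g \<in> borel_measurable lebesgue"
    and "schwartz_limit f" "schwartz_limit g"
  shows "schwartz_limit (\<lambda>x. f x + g x)"
proof -
  obtain \<phi> \<psi> where \<phi>: "\<And>k. schwartz (\<phi> k)" "(\<lambda>k::nat. energy (\<lambda>x. \<phi> k x - f x)) \<longlonglongrightarrow> 0"
    and \<psi>: "\<And>k. schwartz (\<psi> k)" "(\<lambda>k::nat. energy (\<lambda>x. \<psi> k x - g x)) \<longlonglongrightarrow> 0"
    using assms(3,4) unfolding schwartz_limit_def by blast
  note [measurable] = schwartz_measurable[OF \<phi>(1)] schwartz_measurable[OF \<psi>(1)]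
  have "energy (\<lambda>x. (\<phi> k x + \<psi> k x) - (f x + g x)) \<le> 2 * energy (\<lambda>x. \<phi> k x - f x) + 2 * energy (\<lambda>x. \<psi> k x - g x)" for k
    using energy_add_le[of "\<lambda>x. \<phi> k x - f x" "\<lambda>x. \<psi> k x - g x"] by (simp add: algebra_simps)
  then have "(\<lambda>k. energy (\<lambda>x. (\<phi> k x + \<psi> k x) - (f x + g x))) \<longlonglongrightarrow> 0"
    by (rule tendsto_0_sandwich_ennreal[OF tendsto_0_add_ennreal[OF \<phi>(2) \<psi>(2)], rotated 2]) auto
  then show ?thesis
    unfolding schwartz_limit_def using schwartz_add[OF \<phi>(1) \<psi>(1)] by (intro exI[of _ "\<lambda>k x. \<phi> k x + \<psi> k x"]) auto
qed

lemma schwartz_limit_cmult: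
  assumes [measurable]: "f \<in> borel_measurable lebesgue" and "schwartz_limit f"
  shows "schwartz_limit (\<lambda>x. c * f x)"
proof -
  obtain \<phi> where \<phi>: "\<And>k. schwartz (\<phi> k)" "(\<lambda>k::nat. energy (\<lambda>x. \<phi> k x - f x)) \<longlonglongrightarrow> 0"
    using assms(2) unfolding schwartz_limit_def by blast
  note [measurable] = schwartz_measurable[OF \<phi>(1)]
  have "energy (\<lambda>x. c * \<phi> k x - c * f x) = ennreal ((norm c)\<^sup>2) * energy (\<lambda>x. \<phi> k x - f x)" for k
    unfolding right_diff_distrib[symmetric] by (rule energy_cmult) measurable
  then have "(\<lambda>k. energy (\<lambda>x. c * \<phi> k x - c * f x)) \<longlonglongrightarrow> 0"
    using tendsto_0_add_ennreal[OF \<phi>(2) \<phi>(2), of "ennreal ((norm c)\<^sup>2)" 0] by simp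
  then show ?thesis
    unfolding schwartz_limit_def using schwartz_cmult[OF \<phi>(1)] by (intro exI[of _ "\<lambda>k x. c * \<phi> k x"]) auto
qed

lemma schwartz_limit_sum:
  assumes "\<And>i. i \<in> I \<Longrightarrow> f i \<in> borel_measurable lebesgue" "\<And>i. i \<in> I \<Longrightarrow> schwartz_limit (f i)"
  shows "schwartz_limit (\<lambda>x. \<Sum>i\<in>I. f i x)"
  using assms
  by (induction I rule: infinite_finite_induct)
     (simp_all add: schwartz_limit_add schwartz_limit_schwartz[OF schwartz_zero] borel_measurable_sum)

text \<open>Diagonal choice: a Schwartz function within 1/(j+1) of \<open>g j\<close>, in energy,
  for each \<open>j\<close>.\<close>

lemma schwartz_limit_closed:
  assumes [measurable]: "\<And>j. g j \<in> borel_measurable lebesgue" "f \<in> borel_measurable lebesgue"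
    and g: "\<And>j. schwartz_limit (g j)" and lim: "(\<lambda>j. energy (\<lambda>x. g j x - f x)) \<longlonglongrightarrow> 0"
  shows "schwartz_limit f"
proof -
  have "\<exists>\<phi>. schwartz \<phi> \<and> energy (\<lambda>x. \<phi> x - g j x) < ennreal (inverse (real (Suc j)))" for j
  proof -
    obtain \<phi> where \<phi>: "\<And>k. schwartz (\<phi> k)" "(\<lambda>k::nat. energy (\<lambda>x. \<phi> k x - g j x)) \<longlonglongrightarrow> 0"
      using g[of j] unfolding schwartz_limit_def by blast
    have "eventually (\<lambda>k. energy (\<lambda>x. \<phi> k x - g j x) < ennreal (inverse (real (Suc j)))) sequentially"
      by (rule order_tendstoD(2)[OF \<phi>(2)]) simp
    then show ?thesis using \<phi>(1) eventually_happens'[OF sequentially_bot] by blast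
  qed
  then obtain \<phi> where \<phi>: "\<And>j. schwartz (\<phi> j)" "\<And>j. energy (\<lambda>x. \<phi> j x - g j x) < ennreal (inverse (real (Suc j)))"
    by metis
  note [measurable] = schwartz_measurable[OF \<phi>(1)]
  have le: "energy (\<lambda>x. \<phi> j x - f x) \<le> 2 * ennreal (inverse (real (Suc j))) + 2 * energy (\<lambda>x. g j x - f x)" for j
  proof (rule order_trans[OF energy_triangle[of _ "g j"]])
    show "2 * energy (\<lambda>x. \<phi> j x - g j x) + 2 * energy (\<lambda>x. g j x - f x)
        \<le> 2 * ennreal (inverse (real (Suc j))) + 2 * energy (\<lambda>x. g j x - f x)"
      using \<phi>(2)[of j] by (intro add_right_mono mult_left_mono less_imp_le) auto
  qed measurable
  have "(\<lambda>j. ennreal (inverse (real (Suc j)))) \<longlonglongrightarrow> 0"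
    using tendsto_ennrealI[OF LIMSEQ_inverse_real_of_nat] by simp
  then have "(\<lambda>j. 2 * ennreal (inverse (real (Suc j))) + 2 * energy (\<lambda>x. g j x - f x)) \<longlonglongrightarrow> 0"
    by (rule tendsto_0_add_ennreal[OF _ lim]) auto
  then have "(\<lambda>j. energy (\<lambda>x. \<phi> j x - f x)) \<longlonglongrightarrow> 0"
    by (rule tendsto_0_sandwich_ennreal[OF _ le])
  then show ?thesis unfolding schwartz_limit_def using \<phi>(1) by blast
qed

lemma energy_dominated_convergence:
  fixes f :: "real ^ 'n::finite \<Rightarrow> complex" and w :: "real ^ 'n \<Rightarrow> complex"
  assumes [measurable]: "\<And>k. g k \<in> borel_measurable lebesgue" "f \<in> borel_measurable lebesgue" "w \<in> borel_measurable lebesgue"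
    and lim: "AE x in lebesgue. (\<lambda>k. g k x) \<longlonglongrightarrow> f x"
    and b: "\<And>k x. norm (g k x) \<le> norm (w x)" "\<And>x. norm (f x) \<le> norm (w x)"
    and w: "energy w < \<infinity>"
  shows "(\<lambda>k::nat. energy (\<lambda>x. g k x - f x)) \<longlonglongrightarrow> 0"
proof -
  have "(\<lambda>k. \<integral>\<^sup>+ x. ennreal ((norm (g k x - f x))\<^sup>2) \<partial>lebesgue) \<longlonglongrightarrow> (\<integral>\<^sup>+ (x::real^'n). 0 \<partial>lebesgue)"
  \<comment> \<open>Both the sequence and its limit are bounded by \<open>w\<close>, hence their
    difference by \<open>2 * w\<close>.\<close>
  proof (rule nn_integral_dominated_convergence[where w="\<lambda>x. ennreal ((norm (2 * w x))\<^sup>2)"])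
    show "AE x in lebesgue. ennreal ((norm (g k x - f x))\<^sup>2) \<le> ennreal ((norm (2 * w x))\<^sup>2)" for k
    proof (intro AE_I2 ennreal_leI power_mono)
      show "norm (g k x - f x) \<le> norm (2 * w x)" for x
        using norm_triangle_ineq4[of "g k x" "f x"] b(1)[of k x] b(2)[of x] by (simp add: norm_mult)
    qed simp
    show "(\<integral>\<^sup>+ x. ennreal ((norm (2 * w x))\<^sup>2) \<partial>lebesgue) < \<infinity>"
      using w energy_cmult[of w 2] unfolding energy_def by (simp add: ennreal_mult_less_top)
    show "AE x in lebesgue. (\<lambda>k. ennreal ((norm (g k x - f x))\<^sup>2)) \<longlonglongrightarrow> 0"
      using lim
    proof eventually_elim
      fix x assume "(\<lambda>k. g k x) \<longlonglongrightarrow> f x"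
      then have "(\<lambda>k. ennreal ((norm (g k x - f x))\<^sup>2)) \<longlonglongrightarrow> ennreal ((norm (f x - f x))\<^sup>2)"
        by (intro tendsto_ennrealI tendsto_intros)
      then show "(\<lambda>k. ennreal ((norm (g k x - f x))\<^sup>2)) \<longlonglongrightarrow> 0" by simp
    qed
  qed measurable
  then show ?thesis by (simp add: energy_def)
qed

section \<open>Schwartz approximation of the indicator of a box\<close>

lemma one_plus_power_le_exp:
  fixes T :: real assumes "0 \<le> T"
  shows "(1 + T) ^ N \<le> real (Suc N) ^ Suc N * exp T"
proof -
  \<comment> \<open>The inequality 1 + y \<le> exp y is applied at y = T / (N + 1);
    \<open>Suc N\<close> instead of \<open>N\<close> keeps the divisor nonzero when \<open>N\<close>
    is 0.\<close>
  have "1 + T \<le> real (Suc N) * (1 + T / real (Suc N))"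
    using assms by (simp add: field_simps)
  also have "\<dots> \<le> real (Suc N) * exp (T / real (Suc N))"
    by (intro mult_left_mono exp_ge_add_one_self) simp
  finally have "(1 + T) ^ Suc N \<le> (real (Suc N) * exp (T / real (Suc N))) ^ Suc N"
    using assms by (intro power_mono) auto
  also have "\<dots> = real (Suc N) ^ Suc N * exp T"
    unfolding power_mult_distrib exp_of_nat_mult[symmetric] by simp
  finally show ?thesis
    using power_increasing[of N "Suc N" "1 + T"] assms by linarith
qed

text \<open>The affine coordinate that sends the side from \<open>a $ i\<close> to
  \<open>b $ i\<close> onto the interval from -1 to 1.\<close>

definition box_coord :: "real ^ 'n::finite \<Rightarrow> real ^ 'n \<Rightarrow> 'n \<Rightarrow> real ^ 'n \<Rightarrow> real" where
  "box_coord a b i x = (x $ i - (a $ i + b $ i) / 2) / ((b $ i - a $ i) / 2)"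

text \<open>The Gaussian here is the envelope common to all \<open>box_bump a b k\<close>. With T
  the sum of squared box coordinates, |x| is at most A (1 + T), so polynomial growth in
  \<open>x\<close> is polynomial growth in T, which exp(-T) outweighs.\<close>

lemma gaussian_bump_decay:
  fixes a b :: "real ^ 'n::finite"
  assumes ab: "\<And>i. a $ i < b $ i"
  shows "\<exists>C. \<forall>x. (1 + norm x) ^ N * exp (real CARD('n) - (\<Sum>i\<in>UNIV. (box_coord a b i x)\<^sup>2)) \<le> C"
proof -
  define c where "c i = (a $ i + b $ i) / 2" for i
  define r where "r i = (b $ i - a $ i) / 2" for i
  have r: "0 < r i" for i using ab[of i] by (simp add: r_def)
  \<comment> \<open>A bound for all coordinates at once: distance of the centre from 0 plus half
    side length, summed over the directions.\<close>
  define A where "A = (\<Sum>i\<in>UNIV. \<bar>c i\<bar> + r i)"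
  have A0: "0 \<le> A" unfolding A_def using r by (intro sum_nonneg) (auto simp: less_imp_le)
  define T where "T x = (\<Sum>i\<in>UNIV. (box_coord a b i x)\<^sup>2)" for x
  have T0: "0 \<le> T x" for x unfolding T_def by (intro sum_nonneg) simp
  have "(1 + norm x) ^ N * exp (real CARD('n) - T x) \<le> (1 + A) ^ N * real (Suc N) ^ Suc N * exp (real CARD('n))" for x
  proof -
    have "\<bar>x $ i\<bar> \<le> (\<bar>c i\<bar> + r i) * (1 + T x)" for i
    proof -
      let ?t = "box_coord a b i x"
      have "x $ i = c i + r i * ?t"
        using r[of i] by (simp add: box_coord_def c_def r_def field_simps)
      then have "\<bar>x $ i\<bar> \<le> \<bar>c i\<bar> + r i * \<bar>?t\<bar>"
        using r[of i] abs_triangle_ineq[of "c i" "r i * ?t"] by (simp add: abs_mult)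
      also have "\<bar>?t\<bar> \<le> 1 + ?t\<^sup>2"
      proof -
        have "0 \<le> ?t\<^sup>2 + 1 - 2 * \<bar>?t\<bar>" using zero_le_power2[of "\<bar>?t\<bar> - 1"] by (simp add: power2_diff)
        then show ?thesis using abs_ge_zero[of ?t] by linarith
      qed
      also have "?t\<^sup>2 \<le> T x"
        unfolding T_def by (rule member_le_sum) auto
      finally have "\<bar>x $ i\<bar> \<le> \<bar>c i\<bar> + r i * (1 + T x)" using r[of i] by simp
      also have "\<dots> \<le> (\<bar>c i\<bar> + r i) * (1 + T x)" using T0[of x] by (simp add: algebra_simps)
      finally show ?thesis .
    qed
    then have "norm x \<le> A * (1 + T x)"
      unfolding A_def sum_distrib_right using norm_le_l1_cart[of x] by (meson order_trans sum_mono)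
    then have "1 + norm x \<le> (1 + A) * (1 + T x)" using T0[of x] by (simp add: algebra_simps)
    then have "(1 + norm x) ^ N \<le> (1 + A) ^ N * (1 + T x) ^ N"
      unfolding power_mult_distrib[symmetric] by (intro power_mono) auto
    also have "\<dots> \<le> (1 + A) ^ N * (real (Suc N) ^ Suc N * exp (T x))"
      using A0 by (intro mult_left_mono one_plus_power_le_exp T0) auto
    finally have "(1 + norm x) ^ N * exp (real CARD('n) - T x)
        \<le> (1 + A) ^ N * (real (Suc N) ^ Suc N * exp (T x)) * exp (real CARD('n) - T x)"
      by (rule mult_right_mono) simp
    also have "\<dots> = (1 + A) ^ N * real (Suc N) ^ Suc N * exp (real CARD('n))"
      by (simp add: exp_diff)
    finally show ?thesis .
  qed
  then show ?thesis unfolding T_def by blast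
qed

text \<open>As \<open>k\<close> grows, these Schwartz functions tend to the indicator of the box off its boundary.\<close>

definition box_bump :: "real ^ 'n::finite \<Rightarrow> real ^ 'n \<Rightarrow> nat \<Rightarrow> real ^ 'n \<Rightarrow> real" where
  "box_bump a b k x = exp (- (\<Sum>i\<in>UNIV. (box_coord a b i x) ^ (2 * Suc k)))"

text \<open>Summing t^2 - 1 \<le> t^(2k+2) over the n coordinates produces the n in the exponent.
  The envelope does not depend on \<open>k\<close>, which dominated convergence requires.\<close>

lemma box_bump_le:
  fixes a b :: "real ^ 'n::finite"
  shows "box_bump a b k x \<le> exp (real CARD('n) - (\<Sum>i\<in>UNIV. (box_coord a b i x)\<^sup>2))"
proof -
  have "t\<^sup>2 - 1 \<le> t ^ (2 * Suc k)" for t :: real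
  proof (cases "1 \<le> t\<^sup>2")
    case True
    then have "(t\<^sup>2) ^ 1 \<le> (t\<^sup>2) ^ Suc k" by (intro power_increasing) auto
    then show ?thesis unfolding power_mult power_one_right by linarith
  next
    case False
    then show ?thesis using zero_le_power[OF zero_le_power2[of t], of "Suc k"] unfolding power_mult by linarith
  qed
  then have "(\<Sum>i\<in>UNIV. (box_coord a b i x)\<^sup>2 - 1) \<le> (\<Sum>i\<in>UNIV. (box_coord a b i x) ^ (2 * Suc k))"
    by (rule sum_mono)
  then show ?thesis unfolding box_bump_def by (simp add: sum_subtractf)
qed

text \<open>Supplies the derivatives of the constant 1, the smooth factor with which
  \<open>schwartz_exp_mult\<close> is applied to bumps.\<close>

lemma partials_const: "\<exists>d. norm d \<le> 1 \<and> partials js (\<lambda>_. 1) = (\<lambda>_. d)"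
proof (induction js)
  case (Cons j js)
  then obtain d where "partials js (\<lambda>_. 1) = (\<lambda>_. d)" by blast
  then have "partials (j # js) (\<lambda>_. 1) = (\<lambda>_. 0)"
    by (auto simp: fun_eq_iff intro: partial_eqI)
  then show ?case by (intro exI[of _ 0]) auto
qed (auto intro!: exI[of _ 1])

lemma schwartz_box_bump:
  fixes a b :: "real ^ 'n::finite"
  assumes ab: "\<And>i. a $ i < b $ i"
  shows "schwartz (\<lambda>x. of_real (box_bump a b k x))"
proof -
  let ?c = "\<lambda>i. (a $ i + b $ i) / 2" and ?r = "\<lambda>i. (b $ i - a $ i) / 2"
  let ?P = "\<lambda>x::real^'n. (-1) * (\<Sum>i\<in>UNIV. (of_real (1 / ?r i) * (of_real (x $ i) + of_real (- ?c i))) ^ (2 * Suc k)) :: complex"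
  have P: "?P x = of_real (- (\<Sum>i\<in>UNIV. (box_coord a b i x) ^ (2 * Suc k)))" for x
  proof -
    have "of_real (1 / ?r i) * (of_real (x $ i) + of_real (- ?c i)) = complex_of_real (box_coord a b i x)" for i
    proof -
      have "box_coord a b i x = 1 / ?r i * (x $ i + - ?c i)" by (simp add: box_coord_def)
      then show ?thesis by (simp only: of_real_add of_real_mult)
    qed
    then show ?thesis by (simp only: of_real_minus of_real_sum of_real_power mult_minus1)
  qed
  have "schwartz (\<lambda>x. exp (?P x) * (\<lambda>_. 1) x)"
  proof (rule schwartz_exp_mult)
    show "cpoly ?P"
      by (intro cpoly_mult cpoly_const cpoly_power cpoly_sum cpoly_coord cpoly_add)
    show "partials js (\<lambda>_. 1) differentiable at x" for js :: "'n list" and x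
      using partials_const[of js] by auto
    show "\<exists>C. \<forall>x. norm (q x * (exp (?P x) * partials js (\<lambda>_. 1) x)) \<le> C" if q: "cpoly q" for q js
    proof -
      obtain C N where C: "\<And>x. norm (q x) \<le> C * (1 + norm x) ^ N"
        using cpoly_growth[OF q] by blast
      obtain D where D: "\<And>x. (1 + norm x) ^ N * exp (real CARD('n) - (\<Sum>i\<in>UNIV. (box_coord a b i x)\<^sup>2)) \<le> D"
        using gaussian_bump_decay[OF ab] by blast
      obtain d where d: "norm d \<le> 1" "partials js (\<lambda>_. 1) = (\<lambda>_. d)"
        using partials_const by blast
      have "norm (q x * (exp (?P x) * partials js (\<lambda>_. 1) x)) \<le> \<bar>C\<bar> * D" for x
      proof -
        have "norm (q x * (exp (?P x) * partials js (\<lambda>_. 1) x)) = norm (q x) * (box_bump a b k x * norm d)"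
          unfolding norm_mult d P exp_of_real norm_of_real box_bump_def by simp
        also have "\<dots> \<le> (\<bar>C\<bar> * (1 + norm x) ^ N) * (exp (real CARD('n) - (\<Sum>i\<in>UNIV. (box_coord a b i x)\<^sup>2)) * 1)"
        proof (intro mult_mono box_bump_le d)
          show "norm (q x) \<le> \<bar>C\<bar> * (1 + norm x) ^ N"
            using C[of x] by (rule order_trans) (simp add: mult_right_mono)
        qed (auto simp: box_bump_def)
        also have "\<dots> \<le> \<bar>C\<bar> * D"
          using mult_left_mono[OF D[of x], of "\<bar>C\<bar>"] by (simp add: mult.assoc)
        finally show ?thesis .
      qed
      then show ?thesis by blast
    qed
  qed
  then show ?thesis unfolding P box_bump_def exp_of_real by simp
qed

text \<open>Inside the box all coordinates have modulus below 1 and their powers vanish; outside the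
  closed box one of them exceeds 1 and its powers blow up. On the faces some power stays 1 and the
  limit differs from the indicator, hence the exclusion.\<close>

lemma box_bump_tendsto:
  fixes a b :: "real ^ 'n::finite"
  assumes ab: "\<And>i. a $ i < b $ i" and x: "x \<notin> cbox a b - box a b"
  shows "(\<lambda>k. box_bump a b k x) \<longlonglongrightarrow> indicator (box a b) x"
proof (cases "x \<in> box a b")
  case True
  have "(\<lambda>k. (box_coord a b i x) ^ (2 * Suc k)) \<longlonglongrightarrow> 0" for i
  proof -
    have "a $ i < x $ i" "x $ i < b $ i" using True by (auto simp: mem_box_cart)
    then have "\<bar>x $ i - (a $ i + b $ i) / 2\<bar> < (b $ i - a $ i) / 2"
      unfolding abs_less_iff by (auto simp: field_simps)
    moreover have r: "0 < (b $ i - a $ i) / 2" using ab[of i] by simp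
    ultimately have "\<bar>box_coord a b i x\<bar> < 1"
      by (simp only: box_coord_def abs_divide[of _ "(b $ i - a $ i) / 2"] abs_of_pos[OF r] divide_less_eq_1_pos[OF r])
    then have "(box_coord a b i x)\<^sup>2 < 1" by (simp add: abs_square_less_1)
    then have "(\<lambda>k. ((box_coord a b i x)\<^sup>2) ^ k) \<longlonglongrightarrow> 0" by (intro LIMSEQ_realpow_zero) auto
    then show ?thesis unfolding power_mult by (rule LIMSEQ_Suc)
  qed
  then have "(\<lambda>k. box_bump a b k x) \<longlonglongrightarrow> exp (- (\<Sum>i\<in>(UNIV::'n set). 0))"
    unfolding box_bump_def by (intro tendsto_exp tendsto_minus tendsto_sum)
  then show ?thesis using True by simp
next
  case False
  with x have "x \<notin> cbox a b" by blast
  then obtain i where "x $ i < a $ i \<or> b $ i < x $ i" by (auto simp: mem_box_cart not_le)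
  then have "(b $ i - a $ i) / 2 < \<bar>x $ i - (a $ i + b $ i) / 2\<bar>"
  proof
    assume "x $ i < a $ i"
    then show ?thesis
      using abs_ge_minus_self[of "x $ i - (a $ i + b $ i) / 2"] by (simp add: field_simps)
  next
    assume "b $ i < x $ i"
    then show ?thesis
      using abs_ge_self[of "x $ i - (a $ i + b $ i) / 2"] by (simp add: field_simps)
  qed
  moreover have r: "0 < (b $ i - a $ i) / 2" using ab[of i] by simp
  ultimately have "1 < \<bar>box_coord a b i x\<bar>"
    by (simp only: box_coord_def abs_divide[of _ "(b $ i - a $ i) / 2"] abs_of_pos[OF r] less_divide_eq_1_pos[OF r])
  then have t: "1 < (box_coord a b i x)\<^sup>2"
    using power_strict_mono[of 1 "\<bar>box_coord a b i x\<bar>" 2] by simp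
  have le: "box_bump a b k x \<le> inverse (((box_coord a b i x)\<^sup>2) ^ Suc k)" for k
  proof -
    have p: "0 < ((box_coord a b i x)\<^sup>2) ^ Suc k" by (intro zero_less_power order_less_trans[OF zero_less_one t])
    have "((box_coord a b i x)\<^sup>2) ^ Suc k \<le> (\<Sum>i\<in>UNIV. (box_coord a b i x) ^ (2 * Suc k))"
      unfolding power_mult by (rule member_le_sum) auto
    \<comment> \<open>From S < exp S the bump exp(-S) is at most the inverse of a single large
      summand of S.\<close>
    then have "((box_coord a b i x)\<^sup>2) ^ Suc k \<le> exp (\<Sum>i\<in>UNIV. (box_coord a b i x) ^ (2 * Suc k))"
      using exp_ge_add_one_self[of "\<Sum>i\<in>UNIV. (box_coord a b i x) ^ (2 * Suc k)"] by linarith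
    then show ?thesis
      unfolding box_bump_def exp_minus using p by (rule le_imp_inverse_le)
  qed
  have lim: "(\<lambda>k. inverse (((box_coord a b i x)\<^sup>2) ^ Suc k)) \<longlonglongrightarrow> 0"
    using LIMSEQ_Suc[OF LIMSEQ_realpow_zero[of "inverse ((box_coord a b i x)\<^sup>2)"]] t
    by (simp add: power_inverse inverse_less_1_iff)
  have "(\<lambda>k. box_bump a b k x) \<longlonglongrightarrow> 0"
    by (rule tendsto_sandwich[OF _ _ tendsto_const lim]) (use le in \<open>simp_all add: box_bump_def\<close>)
  then show ?thesis using False by simp
qed

lemma schwartz_limit_box: "schwartz_limit (indicator (box a b) :: real ^ 'n::finite \<Rightarrow> complex)"
proof (cases "\<forall>i. a $ i < b $ i")
  case False
  then obtain i where "b $ i \<le> a $ i" by (auto simp: not_less)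
  then have "box a b = {}" unfolding set_eq_iff mem_box_cart by (meson empty_iff not_less order_less_trans)
  then have "indicator (box a b) = (\<lambda>_. 0 :: complex)" by (simp add: fun_eq_iff)
  then show ?thesis using schwartz_limit_schwartz[OF schwartz_zero] by simp
next
  case True
  then have ab: "\<And>i. a $ i < b $ i" by blast
  define w where "w x = complex_of_real (exp (real CARD('n) - (\<Sum>i\<in>UNIV. (box_coord a b i x)\<^sup>2)))" for x
  have wm: "w \<in> borel_measurable lebesgue"
    unfolding w_def[abs_def] box_coord_def by (rule measurable_lebesgue_of_borel) measurable
  have gm: "(\<lambda>x. complex_of_real (box_bump a b k x)) \<in> borel_measurable lebesgue" for k
    by (rule schwartz_measurable[OF schwartz_box_bump[OF ab]])
  have "\<exists>C\<ge>0. \<forall>x. norm (w x) \<le> C * decay_weight x"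
  proof (rule decay_weight_bound)
    fix k
    obtain C where C: "\<And>x. (1 + norm x) ^ k * exp (real CARD('n) - (\<Sum>i\<in>UNIV. (box_coord a b i x)\<^sup>2)) \<le> C"
      using gaussian_bump_decay[OF ab] by blast
    have "norm x ^ k * norm (w x) \<le> C" for x
      using C[of x] by (rule order_trans[rotated]) (auto simp: w_def intro!: mult_right_mono power_mono)
    then show "\<exists>C. \<forall>x. norm x ^ k * norm (w x) \<le> C" by blast
  qed
  then have "energy w < \<infinity>" using energy_finite_of_decay by blast
  moreover have "AE x in lebesgue. (\<lambda>k. complex_of_real (box_bump a b k x)) \<longlonglongrightarrow> indicator (box a b) x"
  proof (rule AE_I')
    show "cbox a b - box a b \<in> null_sets lebesgue"
      using negligible_frontier_interval by (simp add: negligible_iff_null_sets)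
    have "(\<lambda>k. complex_of_real (box_bump a b k x)) \<longlonglongrightarrow> indicator (box a b) x" if "x \<notin> cbox a b - box a b" for x
      using tendsto_of_real[OF box_bump_tendsto[OF ab that], where 'a=complex]
      by (simp add: indicator_def of_bool_def split: if_splits)
    then show "{x \<in> space lebesgue. \<not> (\<lambda>k. complex_of_real (box_bump a b k x)) \<longlonglongrightarrow> indicator (box a b) x} \<subseteq> cbox a b - box a b"
      by blast
  qed
  moreover have "norm (complex_of_real (box_bump a b k x)) \<le> norm (w x)" for k x
    using box_bump_le[of a b k x] by (simp add: w_def box_bump_def)
  \<comment> \<open>Inside the box the n squared coordinates sum to at most n, so the exponent of
    \<open>w\<close> is nonnegative there and \<open>w\<close> is at least 1.\<close>
  moreover have "norm (indicator (box a b) x :: complex) \<le> norm (w x)" for x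
  proof (cases "x \<in> box a b")
    case True
    have "(box_coord a b i x)\<^sup>2 \<le> 1" for i
    proof -
      have "a $ i < x $ i" "x $ i < b $ i" using True by (auto simp: mem_box_cart)
      then have "\<bar>x $ i - (a $ i + b $ i) / 2\<bar> \<le> (b $ i - a $ i) / 2"
        unfolding abs_le_iff by (auto simp: field_simps)
      moreover have r: "0 < (b $ i - a $ i) / 2" using ab[of i] by simp
      ultimately have "\<bar>box_coord a b i x\<bar> \<le> 1"
        by (simp only: box_coord_def abs_divide[of _ "(b $ i - a $ i) / 2"] abs_of_pos[OF r] divide_le_eq_1_pos[OF r])
      then show ?thesis by (simp add: abs_square_le_1)
    qed
    then have "(\<Sum>i\<in>UNIV. (box_coord a b i x)\<^sup>2) \<le> (\<Sum>i\<in>(UNIV::'n set). 1)" by (intro sum_mono)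
    then show ?thesis using True by (simp add: w_def)
  qed simp
  ultimately have "(\<lambda>k. energy (\<lambda>x. of_real (box_bump a b k x) - indicator (box a b) x)) \<longlonglongrightarrow> 0"
    by (intro energy_dominated_convergence[where w=w] gm wm) (auto intro!: measurable_lebesgue_of_borel)
  then show ?thesis
    unfolding schwartz_limit_def using schwartz_box_bump[OF ab] by (intro exI[of _ "\<lambda>k x. of_real (box_bump a b k x)"]) blast
qed

section \<open>From boxes to all square integrable functions\<close>

lemma energy_indicator_box:
  fixes a b :: "real ^ 'n::finite"
  shows "energy (indicator (box a b)) < \<infinity>"
proof -
  have "energy (indicator (box a b)) = (\<integral>\<^sup>+ x. indicator (box a b) x \<partial>lebesgue)"
    unfolding energy_def by (intro nn_integral_cong) (simp add: indicator_def)
  also have "\<dots> = emeasure lborel (box a b)" by simp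
  also have "\<dots> < \<infinity>" by (rule emeasure_lborel_box_finite)
  finally show ?thesis .
qed

lemma borel_measurable_complex_indicator_lebesgue:
  "A \<in> sets lebesgue \<Longrightarrow> (indicator A :: real ^ 'n::finite \<Rightarrow> complex) \<in> borel_measurable lebesgue"
  by simp

text \<open>Induction over the intersection-stable generator of open boxes. Cutting with a fixed box
  keeps energies finite: complements are then differences of two limits, and unions are dominated by
  the indicator of the box.\<close>

lemma schwartz_limit_indicator_borel:
  fixes A :: "(real ^ 'n::finite) set"
  assumes "A \<in> sets borel"
  shows "schwartz_limit (indicator (A \<inter> box l u) :: real ^ 'n \<Rightarrow> complex)"
proof -
  let ?G = "range (\<lambda>(a, b). box a b :: (real ^ 'n) set)"
  have borel: "sigma_sets UNIV ?G = sets borel" by (simp add: borel_eq_box)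
  have m: "(indicator (B \<inter> box l u) :: real ^ 'n \<Rightarrow> complex) \<in> borel_measurable lebesgue" if "B \<in> sigma_sets UNIV ?G" for B
    using that unfolding borel by (intro measurable_lebesgue_of_borel) simp
  have "Int_stable ?G" by (auto simp: Int_stable_def box_Int_box)
  moreover have "?G \<subseteq> Pow UNIV" by simp
  moreover have "A \<in> sigma_sets UNIV ?G" using assms borel by simp
  ultimately show ?thesis
  proof (induction rule: sigma_sets_induct_disjoint)
    case (basic B)
    then show ?case by (auto simp: box_Int_box intro: schwartz_limit_box)
  next
    case empty
    have "indicator ({} \<inter> box l u) = (\<lambda>_::real^'n. 0 :: complex)" by (simp add: fun_eq_iff)
    then show ?case using schwartz_limit_schwartz[OF schwartz_zero] by simp
  next
    case (compl B)
    have "schwartz_limit (\<lambda>x. indicator (box l u) x + (-1) * (indicator (B \<inter> box l u) x :: complex))"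
      using m[OF compl(1)] compl(2)
      by (intro schwartz_limit_add schwartz_limit_cmult schwartz_limit_box borel_measurable_times) auto
    also have "(\<lambda>x. indicator (box l u) x + (-1) * (indicator (B \<inter> box l u) x :: complex)) = indicator ((UNIV - B) \<inter> box l u)"
      by (auto simp: fun_eq_iff indicator_def)
    finally show ?case .
  next
    case (union B)
    define g where "g k = (indicator ((\<Union>i<k. B i) \<inter> box l u) :: real ^ 'n \<Rightarrow> complex)" for k
    have B: "B i \<in> sets borel" for i using union(2) unfolding borel by auto
    have gm: "g k \<in> borel_measurable lebesgue" for k
      unfolding g_def using B by (intro measurable_lebesgue_of_borel) auto
    have "g k = (\<lambda>x. \<Sum>i<k. indicator (B i \<inter> box l u) x)" for k
    proof
      fix x
      have "disjoint_family_on (\<lambda>i. B i \<inter> box l u) {..<k}"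
        using union(1) unfolding disjoint_family_on_def by blast
      then have "indicator (\<Union>i<k. B i \<inter> box l u) x = (\<Sum>i<k. indicator (B i \<inter> box l u) x :: complex)"
        by (intro indicator_UN_disjoint) auto
      then show "g k x = (\<Sum>i<k. indicator (B i \<inter> box l u) x)" by (simp add: g_def)
    qed
    then have lg: "schwartz_limit (g k)" for k
      using union m by (auto intro!: schwartz_limit_sum)
    have lim: "(\<lambda>k. energy (\<lambda>x. g k x - indicator ((\<Union>i. B i) \<inter> box l u) x)) \<longlonglongrightarrow> 0"
    proof (rule energy_dominated_convergence[where w="indicator (box l u)"])
      show "AE x in lebesgue. (\<lambda>k. g k x) \<longlonglongrightarrow> indicator ((\<Union>i. B i) \<inter> box l u) x"
      proof (intro AE_I2)
        show "(\<lambda>k. g k x) \<longlonglongrightarrow> indicator ((\<Union>i. B i) \<inter> box l u) x" for x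
          using LIMSEQ_indicator_UN[of "\<lambda>i. B i \<inter> box l u" x, where 'a=complex] by (simp add: g_def)
      qed
      show "energy (indicator (box l u)) < \<infinity>" by (rule energy_indicator_box)
    qed (use gm B in \<open>auto simp: g_def indicator_def intro!: measurable_lebesgue_of_borel\<close>)
    have im: "(indicator ((\<Union>i. B i) \<inter> box l u) :: real ^ 'n \<Rightarrow> complex) \<in> borel_measurable lebesgue"
      using B by (intro measurable_lebesgue_of_borel) auto
    show ?case by (rule schwartz_limit_closed[OF gm im lg lim])
  qed
qed

lemma schwartz_limit_indicator:
  fixes A :: "(real ^ 'n::finite) set"
  assumes "A \<in> sets lebesgue"
  shows "schwartz_limit (indicator (A \<inter> box l u) :: real ^ 'n \<Rightarrow> complex)"
proof -
  \<comment> \<open>A Lebesgue set is a Borel set up to a null set, which \<open>energy\<close> does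
    not see.\<close>
  obtain S N N' where S: "A = S \<union> N" "N \<subseteq> N'" "N' \<in> null_sets lborel" "S \<in> sets lborel"
    using assms by (rule sets_completionE)
  have "N' \<in> null_sets lebesgue" using S(3) by (rule null_sets_completionI)
  then have "AE x in lebesgue. (indicator (S \<inter> box l u) x :: complex) = indicator (A \<inter> box l u) x"
    by (rule AE_I') (use S in \<open>auto simp: indicator_def\<close>)
  then show ?thesis
    by (rule schwartz_limit_cong_AE) (use schwartz_limit_indicator_borel S(4) in simp)
qed

text \<open>Simple functions converging pointwise to \<open>h\<close> under the bound 2 |h| are cut
  off to growing boxes; each is then a finite combination of indicators of bounded sets.\<close>

theorem schwartz_limit_L2:
  fixes h :: "real ^ 'n::finite \<Rightarrow> complex"
  assumes h: "h \<in> borel_measurable lebesgue" and fin: "energy h < \<infinity>"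
  shows "schwartz_limit h"
proof -
  obtain s where s: "\<And>i. simple_function lebesgue (s i)" "\<And>x. (\<lambda>i. s i x) \<longlonglongrightarrow> h x"
    "\<And>i x. norm (s i x) \<le> 2 * norm (h x)"
    using borel_measurable_implies_sequence_metric[OF h, of 0] by (auto simp: dist_norm)
  define D where "D k = box (- (real k *\<^sub>R One)) (real k *\<^sub>R One :: real ^ 'n)" for k
  define g where "g k x = indicator (D k) x * s k x" for k x
  have sm: "s k \<in> borel_measurable lebesgue" for k
    by (rule borel_measurable_simple_function[OF s(1)])
  have [measurable]: "D k \<in> sets lebesgue" for k unfolding D_def by simp
  have gm: "g k \<in> borel_measurable lebesgue" for k
    unfolding g_def[abs_def] using sm[of k] by measurable
  have lg: "schwartz_limit (g k)" for k
  proof -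
    have V: "s k -` {y} \<in> sets lebesgue" for y
      using simple_functionD(2)[OF s(1), of k "{y}"] by simp
    have "g k = (\<lambda>x. \<Sum>y\<in>range (s k). y * indicator (s k -` {y} \<inter> D k) x)"
    proof
      fix x
      have "s k x = (\<Sum>y\<in>range (s k). indicator (s k -` {y}) x *\<^sub>R y)"
        by (rule simple_function_indicator_representation_banach[OF s(1), of x k, simplified])
      then have "g k x = (\<Sum>y\<in>range (s k). indicator (D k) x * (indicator (s k -` {y}) x *\<^sub>R y))"
        unfolding g_def sum_distrib_left[symmetric] by (rule arg_cong)
      also have "\<dots> = (\<Sum>y\<in>range (s k). y * indicator (s k -` {y} \<inter> D k) x)"
        by (intro sum.cong) (auto simp: indicator_def)
      finally show "g k x = \<dots>" .
    qed
    moreover have "schwartz_limit (\<lambda>x. \<Sum>y\<in>range (s k). y * indicator (s k -` {y} \<inter> D k) x)"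
      using V by (intro schwartz_limit_sum schwartz_limit_cmult)
         (auto simp: D_def intro!: schwartz_limit_indicator borel_measurable_times borel_measurable_complex_indicator_lebesgue)
    ultimately show ?thesis by simp
  qed
  have lim: "(\<lambda>k. energy (\<lambda>x. g k x - h x)) \<longlonglongrightarrow> 0"
  proof (rule energy_dominated_convergence[where w="\<lambda>x. 2 * h x"])
    show "energy (\<lambda>x. 2 * h x) < \<infinity>"
      using fin by (simp add: energy_cmult[OF h] ennreal_mult_less_top)
    show "norm (g k x) \<le> norm (2 * h x)" for k x
      using s(3)[of k x] by (auto simp: g_def indicator_def norm_mult)
    show "AE x in lebesgue. (\<lambda>k. g k x) \<longlonglongrightarrow> h x"
    proof (intro AE_I2)
      fix x
      \<comment> \<open>A point lies in all \<open>D k\<close> from some index on, after which the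
        cut-off changes nothing at that point.\<close>
      obtain K where "x \<in> D K" using UN_box_eq_UNIV unfolding D_def by blast
      then have "x \<in> D k" if "K \<le> k" for k
      proof -
        have "x \<in> D k \<longleftrightarrow> (\<forall>b\<in>Basis. - real k < x \<bullet> b \<and> x \<bullet> b < real k)" for k
          by (simp add: D_def mem_box)
        moreover have "real K \<le> real k" using that by simp
        ultimately show ?thesis using \<open>x \<in> D K\<close> by fastforce
      qed
      then have "eventually (\<lambda>k. s k x = g k x) sequentially"
        unfolding eventually_sequentially by (intro exI[of _ K]) (simp add: g_def)
      then show "(\<lambda>k. g k x) \<longlonglongrightarrow> h x" by (rule Lim_transform_eventually[OF s(2)])
    qed
  qed (use h gm in \<open>auto simp: norm_mult\<close>)
  show ?thesis by (rule schwartz_limit_closed[OF gm h lg lim])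
qed

lemma inv_fourier_schwartz_integrable:
  fixes f :: "real ^ 'n::finite \<Rightarrow> complex"
  assumes "schwartz f" shows "integrable lebesgue (inv_fourier f)"
  using integrable_lebesgue_affine[of "-1" "fourier f" 0] integrable_fourier_schwartz[OF assms]
  by (simp add: inv_fourier_eq[abs_def])

lemma inv_fourier_diff:
  assumes "integrable lebesgue f" "integrable lebesgue g"
  shows "inv_fourier (\<lambda>x. f x - g x) \<xi> = inv_fourier f \<xi> - inv_fourier g \<xi>"
  using assms[THEN integrable_fourier_integrand, of "2 * pi" \<xi>]
  unfolding inv_fourier_def right_diff_distrib by (simp add: inner_commute)

text \<open>The crude constant comes from using the quasi-triangle inequality for \<^const>\<open>energy\<close>.\<close>

lemma energy_le_inv_fourier:
  fixes U :: "real ^ 'n::finite \<Rightarrow> complex"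
  assumes U: "integrable lebesgue U" and fin: "energy U < \<infinity>"
  shows "energy U \<le> 4 * energy (inv_fourier U)"
proof -
  have Um[measurable]: "U \<in> borel_measurable lebesgue" using U by auto
  have Fm[measurable]: "inv_fourier U \<in> borel_measurable lebesgue"
    by (rule borel_measurable_inv_fourier) simp
  obtain \<phi> where \<phi>: "\<And>k. schwartz (\<phi> k)" and lim: "(\<lambda>k::nat. energy (\<lambda>x. \<phi> k x - U x)) \<longlonglongrightarrow> 0"
    using schwartz_limit_L2[OF Um fin] unfolding schwartz_limit_def by blast
  let ?d = "\<lambda>k. energy (\<lambda>x. \<phi> k x - U x)"
  have "energy U \<le> 4 * energy (inv_fourier U) + 6 * ?d k" for k
  proof -
    have \<phi>i: "integrable lebesgue (\<phi> k)" by (rule schwartz_integrable[OF \<phi>])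
    have [measurable]: "\<phi> k \<in> borel_measurable lebesgue" by (rule schwartz_measurable[OF \<phi>])
    have [measurable]: "inv_fourier (\<phi> k) \<in> borel_measurable lebesgue"
      by (rule borel_measurable_inv_fourier) simp
    have 1: "energy U \<le> 2 * energy (\<phi> k) + 2 * ?d k"
      using energy_add_le[of "\<phi> k" "\<lambda>x. U x - \<phi> k x"] by (simp add: energy_minus_commute[of U])
    \<comment> \<open>Inversion lets the upper bound for the transform act as a lower bound for the
      inverse transform.\<close>
    have "\<phi> k = fourier (inv_fourier (\<phi> k))"
      by (rule ext) (rule fourier_inv_fourier[OF \<phi>, symmetric])
    then have "energy (\<phi> k) = energy (fourier (inv_fourier (\<phi> k)))" by (rule arg_cong)
    also have "\<dots> \<le> energy (inv_fourier (\<phi> k))"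
      by (rule energy_fourier_le[OF inv_fourier_schwartz_integrable[OF \<phi>]])
    finally have 2: "energy (\<phi> k) \<le> energy (inv_fourier (\<phi> k))" .
    have 3: "energy (inv_fourier (\<phi> k)) \<le> 2 * energy (inv_fourier U) + 2 * energy (inv_fourier (\<lambda>x. \<phi> k x - U x))"
      using energy_add_le[of "inv_fourier U" "\<lambda>x. inv_fourier (\<phi> k) x - inv_fourier U x"]
      by (simp add: inv_fourier_diff[OF \<phi>i U, abs_def])
    have 4: "energy (inv_fourier (\<lambda>x. \<phi> k x - U x)) \<le> ?d k"
      by (rule energy_inv_fourier_le) (use \<phi>i U in auto)
    \<comment> \<open>Two quasi-triangle inequalities, one on each side of the transform: 2 * 2 = 4
      in front of the main term and 2 * 2 + 2 = 6 in front of the vanishing error.\<close>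
    have "energy U \<le> 2 * (2 * energy (inv_fourier U) + 2 * ?d k) + 2 * ?d k"
      by (rule order_trans[OF 1]) (intro add_right_mono mult_left_mono order_trans[OF 2] order_trans[OF 3] add_left_mono 4, auto)
    also have "\<dots> = 4 * energy (inv_fourier U) + 6 * ?d k"
      by (simp add: distrib_left mult.assoc[symmetric] add.assoc distrib_right[symmetric])
    finally show ?thesis .
  qed
  moreover have "(\<lambda>k. 4 * energy (inv_fourier U) + 6 * ?d k) \<longlonglongrightarrow> 4 * energy (inv_fourier U) + 6 * 0"
    by (intro tendsto_add tendsto_const ennreal_tendsto_cmult lim) auto
  ultimately show ?thesis
    by (intro LIMSEQ_le_const[where X="\<lambda>k. 4 * energy (inv_fourier U) + 6 * ?d k"]) auto
qed

section \<open>The fractional Fourier multiplier\<close>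

lemma Lp_norm_2: "Lp_norm 2 f = (if energy f = \<infinity> then \<infinity> else ennreal (sqrt (enn2real (energy f))))"
proof -
  have "(\<integral>\<^sup>+ x. ennreal (norm (f x) powr enn2real 2) \<partial>lebesgue) = energy f"
    unfolding energy_def by simp
  then show ?thesis unfolding Lp_norm_def by (simp add: Let_def powr_half_sqrt)
qed

lemma Lp_norm_2_square: "Lp_norm 2 f * Lp_norm 2 f = energy f"
  unfolding Lp_norm_2 by (simp add: ennreal_mult[symmetric] less_top)

lemma Lp_norm_2_finite_iff: "Lp_norm 2 f < \<infinity> \<longleftrightarrow> energy f < \<infinity>"
  unfolding Lp_norm_2 by (simp add: less_top)

text \<open>Translates the convergence in \<open>frft_L2\<close> into \<open>energy\<close>.
  Backwards, a norm of at least \<open>e\<close> would force an energy of at least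
  \<open>e * e\<close>, so no continuity of the root on extended reals enters.\<close>

lemma Lp_norm_2_tendsto_0_iff:
  fixes f :: "nat \<Rightarrow> real ^ 'n::finite \<Rightarrow> complex"
  shows "(\<lambda>k. Lp_norm 2 (f k)) \<longlonglongrightarrow> 0 \<longleftrightarrow> (\<lambda>k. energy (f k)) \<longlonglongrightarrow> 0"
proof
  assume "(\<lambda>k. Lp_norm 2 (f k)) \<longlonglongrightarrow> 0"
  then have "(\<lambda>k. Lp_norm 2 (f k) * Lp_norm 2 (f k)) \<longlonglongrightarrow> 0 * 0"
    by (intro tendsto_mult_ennreal) auto
  then show "(\<lambda>k. energy (f k)) \<longlonglongrightarrow> 0" by (simp add: Lp_norm_2_square)
next
  assume E: "(\<lambda>k. energy (f k)) \<longlonglongrightarrow> 0"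
  show "(\<lambda>k. Lp_norm 2 (f k)) \<longlonglongrightarrow> 0"
  proof (rule order_tendstoI)
    fix e :: ennreal assume "0 < e"
    then have "0 < e * e" by (simp add: ennreal_zero_less_mult_iff)
    then have "eventually (\<lambda>k. energy (f k) < e * e) sequentially"
      by (rule order_tendstoD(2)[OF E])
    then show "eventually (\<lambda>k. Lp_norm 2 (f k) < e) sequentially"
    proof eventually_elim
      fix k assume *: "energy (f k) < e * e"
      show "Lp_norm 2 (f k) < e"
      proof (rule ccontr)
        assume "\<not> Lp_norm 2 (f k) < e"
        then have "e * e \<le> Lp_norm 2 (f k) * Lp_norm 2 (f k)" by (intro mult_mono) auto
        then show False using * by (simp add: Lp_norm_2_square)
      qed
    qed
  qed simp
qed

lemma Lp_norm_cong:
  assumes "f \<in> borel_measurable lebesgue" "g \<in> borel_measurable lebesgue"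
    and ae: "AE x in lebesgue. norm (f x) = norm (g x)"
  shows "Lp_norm p f = Lp_norm p g"
proof -
  have "esssup lebesgue (\<lambda>x. ennreal (norm (f x))) = esssup lebesgue (\<lambda>x. ennreal (norm (g x)))"
    using assms by (intro esssup_AE_cong) auto
  moreover have "(\<integral>\<^sup>+ x. ennreal (norm (f x) powr enn2real p) \<partial>lebesgue) = (\<integral>\<^sup>+ x. ennreal (norm (g x) powr enn2real p) \<partial>lebesgue)"
    using ae by (intro nn_integral_cong_AE) auto
  ultimately show ?thesis unfolding Lp_norm_def by simp
qed

lemma chirp_inv_chirp[simp]: "chirp \<alpha> (inv_chirp \<alpha> f) = f"
  and inv_chirp_chirp[simp]: "inv_chirp \<alpha> (chirp \<alpha> f) = f"
  by (auto simp: fun_eq_iff chirp_def inv_chirp_def cis_mult mult.assoc[symmetric])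

lemma norm_chirp[simp]: "norm (chirp \<alpha> f x) = norm (f x)"
  and norm_inv_chirp[simp]: "norm (inv_chirp \<alpha> f x) = norm (f x)"
  by (simp_all add: chirp_def inv_chirp_def norm_mult)

lemma energy_chirp_diff: "energy (\<lambda>x. chirp \<alpha> f x - chirp \<alpha> g x) = energy (\<lambda>x. f x - g x)"
  unfolding energy_def chirp_def right_diff_distrib[symmetric] norm_mult by simp

lemma borel_measurable_inv_chirp:
  assumes [measurable]: "f \<in> borel_measurable lebesgue"
  shows "inv_chirp \<alpha> f \<in> borel_measurable lebesgue"
  unfolding inv_chirp_def[abs_def] by measurable

text \<open>The power of \<sigma> is the L^2 normalisation of a dilation. Only the modulus of
  \<open>H\<close> enters, so the constant \<open>c\<close> and the outer chirp of
  \<open>frft\<close> drop out.\<close>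

lemma energy_dilate:
  fixes D H :: "real ^ 'n::finite \<Rightarrow> complex"
  assumes \<sigma>: "\<sigma> \<noteq> 0" and [measurable]: "D \<in> borel_measurable lebesgue"
    and H: "\<And>\<xi>. norm (H \<xi>) = \<bar>\<sigma>\<bar> powr (- (real CARD('n) / 2)) * norm (D (\<xi> /\<^sub>R \<sigma>))"
  shows "energy H = energy D"
proof -
  have "(\<bar>\<sigma>\<bar> powr (- (real CARD('n) / 2)))\<^sup>2 = \<bar>\<sigma>\<bar> powr (- (real CARD('n)))"
    by (simp add: power2_eq_square powr_add[symmetric])
  also have "\<dots> = \<bar>inverse \<sigma>\<bar> ^ CARD('n)"
    using \<sigma> by (simp add: powr_minus powr_realpow power_inverse)
  finally have eq: "(\<bar>\<sigma>\<bar> powr (- (real CARD('n) / 2)))\<^sup>2 = \<bar>inverse \<sigma>\<bar> ^ CARD('n)" .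
  define D' where "D' \<xi> = D (0 + inverse \<sigma> *\<^sub>R \<xi>)" for \<xi>
  have [measurable]: "D' \<in> borel_measurable lebesgue"
    unfolding D'_def[abs_def] using \<sigma> by (intro borel_measurable_lebesgue_affine) auto
  have "energy H = (\<integral>\<^sup>+ \<xi>. ennreal (\<bar>inverse \<sigma>\<bar> ^ CARD('n)) * ennreal ((norm (D' \<xi>))\<^sup>2) \<partial>lebesgue)"
    unfolding energy_def H power_mult_distrib eq D'_def by (simp add: ennreal_mult)
  also have "\<dots> = ennreal (\<bar>inverse \<sigma>\<bar> ^ CARD('n)) * (\<integral>\<^sup>+ \<xi>. ennreal ((norm (D' \<xi>))\<^sup>2) \<partial>lebesgue)"
    by (intro nn_integral_cmult) measurable
  also have "\<dots> = energy D"
    unfolding energy_def D'_def using \<sigma> nn_integral_lebesgue_affine[of "inverse \<sigma>" "\<lambda>x. ennreal ((norm (D x))\<^sup>2)" 0]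
    by simp
  finally show ?thesis .
qed

section \<open>One multiplier acting on one Schwartz function\<close>

locale frft_multiplier =
  fixes \<alpha> :: real and c :: complex and m :: "real ^ 'n::finite \<Rightarrow> complex" and f :: "real ^ 'n \<Rightarrow> complex"
  assumes sin_nonzero: "sin \<alpha> \<noteq> 0" and norm_c: "norm c = 1"
    and m_measurable: "m \<in> borel_measurable lebesgue" and m_bounded: "bounded (range m)"
    and f: "schwartz f"
begin

definition u :: "real ^ 'n \<Rightarrow> complex" where
  "u \<eta> = m (sin \<alpha> *\<^sub>R \<eta>) * fourier (chirp \<alpha> f) \<eta>"

definition G :: "real ^ 'n \<Rightarrow> complex" where
  "G \<xi> = m \<xi> * frft c \<alpha> f \<xi>"

lemma measurable_u: "u \<in> borel_measurable lebesgue"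
proof -
  have "(\<lambda>\<eta>. m (0 + sin \<alpha> *\<^sub>R \<eta>)) \<in> borel_measurable lebesgue"
    by (rule borel_measurable_lebesgue_affine[OF sin_nonzero m_measurable])
  moreover have "fourier (chirp \<alpha> f) \<in> borel_measurable lebesgue"
    by (intro borel_measurable_fourier schwartz_measurable schwartz_chirp f)
  ultimately show ?thesis unfolding u_def[abs_def] by (intro borel_measurable_times) auto
qed

lemma u_decay: "\<exists>C. \<forall>\<eta>. norm (u \<eta>) \<le> C * decay_weight \<eta>"
proof -
  obtain B where B: "\<And>x. norm (m x) \<le> B" using m_bounded by (auto simp: bounded_iff)
  obtain C where C: "\<And>\<eta>. norm (fourier (chirp \<alpha> f) \<eta>) \<le> C * decay_weight \<eta>"
    using fourier_decay[OF schwartz_chirp[OF f]] by blast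
  have "norm (u \<eta>) \<le> (B * C) * decay_weight \<eta>" for \<eta>
    unfolding u_def norm_mult mult.assoc using B C by (intro mult_mono order_trans[OF norm_ge_zero B]) auto
  then show ?thesis by blast
qed

lemma integrable_u: "integrable lebesgue u"
  using u_decay integrable_of_decay[OF measurable_u] by blast

lemma energy_u: "energy u < \<infinity>"
  using u_decay energy_finite_of_decay by blast

text \<open>The scalars make one identity serve twice: \<open>a = 1\<close> and
  \<open>b = m \<xi>\<close> give the error against \<open>G\<close>, while \<open>a = 0\<close>
  gives \<open>G\<close> itself.\<close>

lemma frft_diff:
  fixes \<phi> \<psi> :: "real ^ 'n \<Rightarrow> complex"
  shows "norm (a * frft c \<alpha> \<phi> \<xi> - b * frft c \<alpha> \<psi> \<xi>) =
     \<bar>sin \<alpha>\<bar> powr (- (real CARD('n) / 2)) * norm (a * fourier (chirp \<alpha> \<phi>) (\<xi> /\<^sub>R sin \<alpha>) - b * fourier (chirp \<alpha> \<psi>) (\<xi> /\<^sub>R sin \<alpha>))"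
proof -
  let ?K = "c * of_real (\<bar>sin \<alpha>\<bar> powr (- (real CARD('n) / 2))) * cis (pi * (norm \<xi>)\<^sup>2 * cot \<alpha>)"
  have "a * frft c \<alpha> \<phi> \<xi> - b * frft c \<alpha> \<psi> \<xi>
      = ?K * (a * fourier (chirp \<alpha> \<phi>) (\<xi> /\<^sub>R sin \<alpha>) - b * fourier (chirp \<alpha> \<psi>) (\<xi> /\<^sub>R sin \<alpha>))"
    unfolding frft_def by (simp add: algebra_simps)
  moreover have "norm ?K = \<bar>sin \<alpha>\<bar> powr (- (real CARD('n) / 2))"
    by (simp add: norm_mult norm_c)
  ultimately show ?thesis by (simp only: norm_mult)
qed

lemma energy_frft_diff:
  assumes "schwartz \<phi>"
  shows "energy (\<lambda>\<xi>. frft c \<alpha> \<phi> \<xi> - G \<xi>) = energy (\<lambda>\<eta>. fourier (chirp \<alpha> \<phi>) \<eta> - u \<eta>)"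
proof (rule energy_dilate[OF sin_nonzero])
  show "(\<lambda>\<eta>. fourier (chirp \<alpha> \<phi>) \<eta> - u \<eta>) \<in> borel_measurable lebesgue"
    by (intro borel_measurable_diff measurable_u borel_measurable_fourier schwartz_measurable schwartz_chirp assms)
  \<comment> \<open>At the frequency \<xi> / sin \<alpha> the dilated multiplier inside
    \<open>u\<close> takes the value \<open>m \<xi>\<close>; this is the origin of the dilation in
    the theorem.\<close>
  show "norm (frft c \<alpha> \<phi> \<xi> - G \<xi>) = \<bar>sin \<alpha>\<bar> powr (- (real CARD('n) / 2)) *
      norm (fourier (chirp \<alpha> \<phi>) (\<xi> /\<^sub>R sin \<alpha>) - u (\<xi> /\<^sub>R sin \<alpha>))" for \<xi>
    using frft_diff[of 1 \<phi> \<xi> "m \<xi>" f] sin_nonzero by (simp add: G_def u_def)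
qed

lemma L2_G: "L2_fun G"
proof -
  have Fm: "(\<lambda>\<xi>. fourier (chirp \<alpha> f) (0 + inverse (sin \<alpha>) *\<^sub>R \<xi>)) \<in> borel_measurable lebesgue"
    using sin_nonzero by (intro borel_measurable_lebesgue_affine borel_measurable_fourier schwartz_measurable schwartz_chirp f) simp
  note [measurable] = m_measurable Fm[simplified]
  have "G \<in> borel_measurable lebesgue"
    unfolding G_def[abs_def] frft_def by measurable
  moreover have "energy G = energy u"
  proof (rule energy_dilate[OF sin_nonzero measurable_u])
    show "norm (G \<xi>) = \<bar>sin \<alpha>\<bar> powr (- (real CARD('n) / 2)) * norm (u (\<xi> /\<^sub>R sin \<alpha>))" for \<xi>
      using frft_diff[of 0 f \<xi> "m \<xi>" f] sin_nonzero by (simp add: G_def u_def)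
  qed
  ultimately show ?thesis
    using energy_u unfolding L2_fun_def Lp_norm_2_finite_iff by simp
qed

lemma inv_fourier_error:
  assumes "schwartz \<psi>"
  shows "inv_fourier (\<lambda>\<eta>. fourier \<psi> \<eta> - u \<eta>) = (\<lambda>x. \<psi> x - inv_fourier u x)"
  by (rule ext) (simp add: inv_fourier_diff integrable_fourier_schwartz[OF assms] integrable_u inv_fourier_fourier[OF assms])

lemma energy_error_le:
  assumes "schwartz \<psi>"
  shows "energy (\<lambda>x. \<psi> x - inv_fourier u x) \<le> energy (\<lambda>\<eta>. fourier \<psi> \<eta> - u \<eta>)"
  unfolding inv_fourier_error[OF assms, symmetric]
  by (intro energy_inv_fourier_le Bochner_Integration.integrable_diff integrable_fourier_schwartz assms integrable_u)

text \<open>This direction serves existence, where approximation is arranged in space and wanted in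
  frequency; \<open>energy_error_le\<close> serves uniqueness.\<close>

lemma energy_error_ge:
  assumes \<psi>: "schwartz \<psi>"
  shows "energy (\<lambda>\<eta>. fourier \<psi> \<eta> - u \<eta>) \<le> 4 * energy (\<lambda>x. \<psi> x - inv_fourier u x)"
  unfolding inv_fourier_error[OF assms, symmetric]
proof (rule energy_le_inv_fourier)
  show "integrable lebesgue (\<lambda>\<eta>. fourier \<psi> \<eta> - u \<eta>)"
    by (intro Bochner_Integration.integrable_diff integrable_fourier_schwartz assms integrable_u)
  obtain C D where C: "\<And>\<eta>. norm (u \<eta>) \<le> C * decay_weight \<eta>" and D: "\<And>\<eta>. norm (fourier \<psi> \<eta>) \<le> D * decay_weight \<eta>"
    using u_decay fourier_decay[OF \<psi>] by blast
  have "norm (fourier \<psi> \<eta> - u \<eta>) \<le> (D + C) * decay_weight \<eta>" for \<eta>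
    using norm_triangle_ineq4[of "fourier \<psi> \<eta>" "u \<eta>"] C[of \<eta>] D[of \<eta>] by (simp add: distrib_right)
  then show "energy (\<lambda>\<eta>. fourier \<psi> \<eta> - u \<eta>) < \<infinity>" by (rule energy_finite_of_decay)
qed

definition h0 :: "real ^ 'n \<Rightarrow> complex" where
  "h0 = inv_chirp \<alpha> (inv_fourier u)"

lemma measurable_h0: "h0 \<in> borel_measurable lebesgue"
  unfolding h0_def by (intro borel_measurable_inv_chirp borel_measurable_inv_fourier measurable_u)

lemma energy_inv_fourier_u: "energy (inv_fourier u) < \<infinity>"
  using energy_inv_fourier_le[OF integrable_u] energy_u by (rule order_le_less_trans)

lemma energy_h0_diff: "energy (\<lambda>x. \<phi> x - h0 x) = energy (\<lambda>x. chirp \<alpha> \<phi> x - inv_fourier u x)"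
  using energy_chirp_diff[of \<alpha> \<phi> h0] by (simp add: h0_def)

lemma frft_L2_h0: "frft_L2 c \<alpha> h0 G"
proof -
  have "energy h0 = energy (inv_fourier u)" by (simp add: energy_def h0_def)
  then have h0: "L2_fun h0"
    using energy_inv_fourier_u measurable_h0 unfolding L2_fun_def Lp_norm_2_finite_iff by simp
  obtain \<psi> where \<psi>: "\<And>k. schwartz (\<psi> k)" and lim: "(\<lambda>k::nat. energy (\<lambda>x. \<psi> k x - inv_fourier u x)) \<longlonglongrightarrow> 0"
    using schwartz_limit_L2[OF borel_measurable_inv_fourier[OF measurable_u] energy_inv_fourier_u]
    unfolding schwartz_limit_def by blast
  have "energy (\<lambda>\<xi>. frft c \<alpha> (inv_chirp \<alpha> (\<psi> k)) \<xi> - G \<xi>) \<le> 4 * energy (\<lambda>x. \<psi> k x - inv_fourier u x)" for k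
    using energy_error_ge[OF \<psi>, of k] by (simp add: energy_frft_diff schwartz_inv_chirp \<psi>)
  moreover have "(\<lambda>k. 4 * energy (\<lambda>x. \<psi> k x - inv_fourier u x)) \<longlonglongrightarrow> 0"
    using tendsto_0_add_ennreal[OF lim lim, of 4 0] by simp
  ultimately have "(\<lambda>k. energy (\<lambda>\<xi>. frft c \<alpha> (inv_chirp \<alpha> (\<psi> k)) \<xi> - G \<xi>)) \<longlonglongrightarrow> 0"
    by (rule tendsto_0_sandwich_ennreal[rotated])
  moreover have "(\<lambda>k. energy (\<lambda>x. inv_chirp \<alpha> (\<psi> k) x - h0 x)) \<longlonglongrightarrow> 0"
    using lim by (simp add: energy_h0_diff)
  ultimately show ?thesis
    unfolding frft_L2_def Lp_norm_2_tendsto_0_iff using h0 L2_G schwartz_inv_chirp[OF \<psi>]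
    by (intro conjI exI[of _ "\<lambda>k. inv_chirp \<alpha> (\<psi> k)"]) auto
qed

lemma frft_L2_unique:
  assumes "frft_L2 c \<alpha> h G"
  shows "AE x in lebesgue. h x = h0 x"
proof -
  obtain \<phi> where \<phi>: "\<And>k::nat. schwartz (\<phi> k)"
    and 1: "(\<lambda>k. energy (\<lambda>x. \<phi> k x - h x)) \<longlonglongrightarrow> 0"
    and 2: "(\<lambda>k. energy (\<lambda>\<xi>. frft c \<alpha> (\<phi> k) \<xi> - G \<xi>)) \<longlonglongrightarrow> 0"
    using assms unfolding frft_L2_def Lp_norm_2_tendsto_0_iff by blast
  have [measurable]: "h \<in> borel_measurable lebesgue"
    using assms by (simp add: frft_L2_def L2_fun_def)
  note [measurable] = measurable_h0 schwartz_measurable[OF \<phi>]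
  have "energy (\<lambda>x. h x - h0 x) \<le> 2 * energy (\<lambda>x. \<phi> k x - h x) + 2 * energy (\<lambda>\<xi>. frft c \<alpha> (\<phi> k) \<xi> - G \<xi>)" for k
  proof -
    have "energy (\<lambda>x. \<phi> k x - h0 x) \<le> energy (\<lambda>\<xi>. frft c \<alpha> (\<phi> k) \<xi> - G \<xi>)"
      unfolding energy_h0_diff energy_frft_diff[OF \<phi>] by (rule energy_error_le[OF schwartz_chirp[OF \<phi>]])
    moreover have "energy (\<lambda>x. h x - h0 x) \<le> 2 * energy (\<lambda>x. h x - \<phi> k x) + 2 * energy (\<lambda>x. \<phi> k x - h0 x)"
      by (rule energy_triangle) measurable
    ultimately show ?thesis
      unfolding energy_minus_commute[of h] by (meson add_left_mono mult_left_mono order_trans zero_le)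
  qed
  \<comment> \<open>The left side does not depend on \<open>k\<close>, while both errors on the
    right tend to 0.\<close>
  then have "energy (\<lambda>x. h x - h0 x) \<le> 0"
    by (intro LIMSEQ_le_const[OF tendsto_0_add_ennreal[OF 1 2, of 2 2]]) auto
  then have "AE x in lebesgue. ennreal ((norm (h x - h0 x))\<^sup>2) = 0"
    unfolding energy_def by (subst (asm) le_zero_eq, subst (asm) nn_integral_0_iff_AE) auto
  then show ?thesis by eventually_elim simp
qed

text \<open>With \<open>h0\<close> as a witness, the choice in \<open>inv_frft\<close> returns a
  genuine preimage of \<open>G\<close>, whichever representative it picks.\<close>

lemma frft_L2_frft_mult: "frft_L2 c \<alpha> (frft_mult c \<alpha> m f) G"
  unfolding frft_mult_def inv_frft_def G_def[abs_def, symmetric] by (rule someI[where P="\<lambda>h. frft_L2 c \<alpha> h G", OF frft_L2_h0])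

lemma fourier_mult_eq: "fourier_mult (\<lambda>\<xi>. m (sin \<alpha> *\<^sub>R \<xi>)) (chirp \<alpha> f) = inv_fourier u"
  by (simp add: fourier_mult_def u_def[abs_def])

lemma frft_mult_AE:
  "AE x in lebesgue. frft_mult c \<alpha> m f x = inv_chirp \<alpha> (fourier_mult (\<lambda>\<xi>. m (sin \<alpha> *\<^sub>R \<xi>)) (chirp \<alpha> f)) x"
  using frft_L2_unique[OF frft_L2_frft_mult] by (simp add: fourier_mult_eq h0_def)

lemma Lp_norm_frft_mult:
  "Lp_norm p (frft_mult c \<alpha> m f) = Lp_norm p (fourier_mult (\<lambda>\<xi>. m (sin \<alpha> *\<^sub>R \<xi>)) (chirp \<alpha> f))"
proof (rule Lp_norm_cong)
  show "frft_mult c \<alpha> m f \<in> borel_measurable lebesgue"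
    using frft_L2_frft_mult by (simp add: frft_L2_def L2_fun_def)
  show "fourier_mult (\<lambda>\<xi>. m (sin \<alpha> *\<^sub>R \<xi>)) (chirp \<alpha> f) \<in> borel_measurable lebesgue"
    unfolding fourier_mult_eq by (intro borel_measurable_inv_fourier measurable_u)
  show "AE x in lebesgue. norm (frft_mult c \<alpha> m f x) = norm (fourier_mult (\<lambda>\<xi>. m (sin \<alpha> *\<^sub>R \<xi>)) (chirp \<alpha> f) x)"
    using frft_mult_AE by eventually_elim simp
qed

end

lemma Lp_norm_chirp: "Lp_norm p (chirp \<alpha> f) = Lp_norm p f"
  by (simp add: Lp_norm_def)

lemma chirp_image_schwartz:
  "chirp \<alpha> ` {f. schwartz f \<and> f \<noteq> (\<lambda>_. 0)} = {f. schwartz f \<and> f \<noteq> (\<lambda>_. 0)}"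
proof -
  have [simp]: "chirp \<alpha> f = (\<lambda>_. 0) \<longleftrightarrow> f = (\<lambda>_. 0)" "inv_chirp \<alpha> f = (\<lambda>_. 0) \<longleftrightarrow> f = (\<lambda>_. 0)" for f :: "real ^ 'a \<Rightarrow> complex"
    by (simp_all add: fun_eq_iff chirp_def inv_chirp_def)
  have "f \<in> chirp \<alpha> ` {f. schwartz f \<and> f \<noteq> (\<lambda>_. 0)}" if "schwartz f" "f \<noteq> (\<lambda>_. 0)" for f :: "real ^ 'a \<Rightarrow> complex"
    using that by (intro image_eqI[of _ _ "inv_chirp \<alpha> f"]) (auto simp: schwartz_inv_chirp)
  then show ?thesis by (auto simp: schwartz_chirp)
qed

theorem proposition3p4:
  fixes \<alpha> :: real and c :: complex and m :: "real ^ 'n::finite \<Rightarrow> complex"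
  assumes "\<forall>k::int. \<alpha> \<noteq> of_int k * pi"
    and "norm c = 1"
    and "m \<in> borel_measurable lebesgue"
    and "bounded (range m)"
  defines "m\<^sub>\<alpha> \<equiv> \<lambda>\<xi>. m (sin \<alpha> *\<^sub>R \<xi>)"
  shows "(\<forall>f. schwartz f \<longrightarrow>
            (AE x in lebesgue.
               frft_mult c \<alpha> m f x = inv_chirp \<alpha> (fourier_mult m\<^sub>\<alpha> (chirp \<alpha> f)) x)) \<and>
         (\<forall>p::ennreal. 1 \<le> p \<longrightarrow>
            Lp_opnorm p (frft_mult c \<alpha> m) = Lp_opnorm p (fourier_mult m\<^sub>\<alpha>))"
proof (intro conjI allI impI)
  have "sin \<alpha> \<noteq> 0" using assms(1) by (auto simp: sin_zero_iff_int2)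
  then have loc: "frft_multiplier \<alpha> c m f" if "schwartz f" for f
    using assms that by unfold_locales auto
  show "AE x in lebesgue. frft_mult c \<alpha> m f x = inv_chirp \<alpha> (fourier_mult m\<^sub>\<alpha> (chirp \<alpha> f)) x" if "schwartz f" for f
    unfolding m\<^sub>\<alpha>_def by (rule frft_multiplier.frft_mult_AE[OF loc[OF that]])
  show "Lp_opnorm p (frft_mult c \<alpha> m) = Lp_opnorm p (fourier_mult m\<^sub>\<alpha>)" for p
  proof -
    let ?A = "{f :: real ^ 'n \<Rightarrow> complex. schwartz f \<and> f \<noteq> (\<lambda>_. 0)}"
    \<comment> \<open>The denominator is chirped as well, which leaves its norm unchanged, so that
      the quotient depends on \<open>chirp \<alpha> f\<close> alone and the supremum can be
      reindexed by the chirp.\<close>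
    have "Lp_opnorm p (frft_mult c \<alpha> m)
        = (SUP f\<in>?A. Lp_norm p (fourier_mult m\<^sub>\<alpha> (chirp \<alpha> f)) / Lp_norm p (chirp \<alpha> f))"
      unfolding Lp_opnorm_def m\<^sub>\<alpha>_def
      by (intro SUP_cong refl) (simp add: frft_multiplier.Lp_norm_frft_mult[OF loc] Lp_norm_chirp)
    also have "\<dots> = (SUP g\<in>chirp \<alpha> ` ?A. Lp_norm p (fourier_mult m\<^sub>\<alpha> g) / Lp_norm p g)"
      by (simp add: image_image)
    also have "\<dots> = Lp_opnorm p (fourier_mult m\<^sub>\<alpha>)"
      unfolding chirp_image_schwartz Lp_opnorm_def ..
    finally show ?thesis .
  qed
qed

end
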